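(* Let $n\ge1$, $s>0$, $\lambda>1$ and $1\le p\le\infty$. Then $$\mathcal{L}^{p}_{s+\ln,\lambda}(\mathbb R^n)\subsetneq\mathcal{L}^{p}_{s+\ln,1}(\mathbb R^n).$$
   Context: The Fourier transform is $\widehat u(\xi)=\int_{\mathbb{R}^n}u(x)e^{-2\pi i x\cdot\xi}\,dx$, extended to $\mathcal S'(\mathbb R^n)$. For $s>0$, $\lambda\ge1$, $(\lambda I-\Delta)^{s+\ln}$ is the Fourier multiplier on $\mathcal S'(\mathbb R^n)$ with (smooth, polynomially bounded) symbol $(\lambda+4\pi^2|\xi|^2)^s\ln(\lambda+4\pi^2|\xi|^2)$, and $$\mathcal L^{p}_{s+\ln,\lambda}(\mathbb R^n)=\{u\in\mathcal S'(\mathbb R^n):(\lambda I-\Delta)^{s+\ln}u\in L^p(\mathbb R^n)\}.$$ *)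

theory Defs
  imports "HOL-Analysis.Analysis"
begin

definition partial_deriv :: "'n \<Rightarrow> (real ^ 'n \<Rightarrow> complex) \<Rightarrow> real ^ 'n \<Rightarrow> complex"
  where "partial_deriv i f x = frechet_derivative f (at x) (axis i 1)"

text \<open>A list of coordinates plays the role of a multi-index. On smooth functions the order of the
  list is irrelevant.\<close>

primrec iter_partial :: "'n list \<Rightarrow> (real ^ 'n \<Rightarrow> complex) \<Rightarrow> real ^ 'n \<Rightarrow> complex" where
  "iter_partial [] f = f"
| "iter_partial (i # is) f = partial_deriv i (iter_partial is f)"

definition smooth :: "(real ^ 'n \<Rightarrow> complex) \<Rightarrow> bool"
  where "smooth f \<longleftrightarrow> (\<forall>is x. iter_partial is f differentiable at x)"

definition schwartz :: "(real ^ 'n \<Rightarrow> complex) set"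
  where "schwartz = {f. smooth f \<and>
    (\<forall>k is. bounded (range (\<lambda>x. (1 + norm x) ^ k * norm (iter_partial is f x))))}"

definition schwartz_seminorm :: "nat \<Rightarrow> 'n list \<Rightarrow> (real ^ 'n \<Rightarrow> complex) \<Rightarrow> real"
  where "schwartz_seminorm k is f = (SUP x. (1 + norm x) ^ k * norm (iter_partial is f x))"

definition schwartz_topology :: "(real ^ 'n \<Rightarrow> complex) topology"
  where "schwartz_topology = topology_generated_by
    {{g \<in> schwartz. schwartz_seminorm k is (\<lambda>x. g x - f x) < e} | k is f e. f \<in> schwartz \<and> e > 0}"

text \<open>Distributions are extensional functions on \<^const>\<open>schwartz\<close> (with value \<^const>\<open>undefined\<close>
  elsewhere), so that equality of distributions is equality of functions.\<close>

definition tempered_distributions :: "((real ^ 'n \<Rightarrow> complex) \<Rightarrow> complex) set"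
  where "tempered_distributions = {u \<in> extensional schwartz.
    (\<forall>f\<in>schwartz. \<forall>g\<in>schwartz. u (\<lambda>x. f x + g x) = u f + u g) \<and>
    (\<forall>c. \<forall>f\<in>schwartz. u (\<lambda>x. c * f x) = c * u f) \<and>
    continuous_map schwartz_topology euclidean u}"

definition fourier :: "(real ^ 'n \<Rightarrow> complex) \<Rightarrow> real ^ 'n \<Rightarrow> complex"
  where "fourier f \<xi> =
    (LINT x|lborel. f x * exp (- 2 * complex_of_real pi * \<i> * complex_of_real (x \<bullet> \<xi>)))"

definition inv_fourier :: "(real ^ 'n \<Rightarrow> complex) \<Rightarrow> real ^ 'n \<Rightarrow> complex"
  where "inv_fourier f x =
    (LINT \<xi>|lborel. f \<xi> * exp (2 * complex_of_real pi * \<i> * complex_of_real (x \<bullet> \<xi>)))"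

text \<open>The operations on tempered distributions are defined by duality.\<close>

definition dist_fourier ::
    "((real ^ 'n \<Rightarrow> complex) \<Rightarrow> complex) \<Rightarrow> (real ^ 'n \<Rightarrow> complex) \<Rightarrow> complex"
  where "dist_fourier u = (\<lambda>f\<in>schwartz. u (fourier f))"

definition dist_inv_fourier ::
    "((real ^ 'n \<Rightarrow> complex) \<Rightarrow> complex) \<Rightarrow> (real ^ 'n \<Rightarrow> complex) \<Rightarrow> complex"
  where "dist_inv_fourier u = (\<lambda>f\<in>schwartz. u (inv_fourier f))"

definition dist_mult :: "(real ^ 'n \<Rightarrow> complex) \<Rightarrow>
    ((real ^ 'n \<Rightarrow> complex) \<Rightarrow> complex) \<Rightarrow> (real ^ 'n \<Rightarrow> complex) \<Rightarrow> complex"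
  where "dist_mult m u = (\<lambda>f\<in>schwartz. u (\<lambda>\<xi>. m \<xi> * f \<xi>))"

definition dist_of_fun :: "(real ^ 'n \<Rightarrow> complex) \<Rightarrow> (real ^ 'n \<Rightarrow> complex) \<Rightarrow> complex"
  where "dist_of_fun h = (\<lambda>f\<in>schwartz. LINT x|lborel. h x * f x)"

definition fourier_multiplier :: "(real ^ 'n \<Rightarrow> complex) \<Rightarrow>
    ((real ^ 'n \<Rightarrow> complex) \<Rightarrow> complex) \<Rightarrow> (real ^ 'n \<Rightarrow> complex) \<Rightarrow> complex"
  where "fourier_multiplier m u = dist_inv_fourier (dist_mult m (dist_fourier u))"

definition log_bessel_symbol :: "real \<Rightarrow> real \<Rightarrow> real ^ 'n \<Rightarrow> complex"
  where "log_bessel_symbol s lam \<xi> = complex_of_real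
    ((lam + 4 * pi\<^sup>2 * (norm \<xi>)\<^sup>2) powr s * ln (lam + 4 * pi\<^sup>2 * (norm \<xi>)\<^sup>2))"

text \<open>The operator \<open>(\<lambda>I - \<Delta>)\<^sup>s\<^sup>+\<^sup>l\<^sup>n\<close>.\<close>

definition log_bessel_op :: "real \<Rightarrow> real \<Rightarrow>
    ((real ^ 'n \<Rightarrow> complex) \<Rightarrow> complex) \<Rightarrow> (real ^ 'n \<Rightarrow> complex) \<Rightarrow> complex"
  where "log_bessel_op s lam = fourier_multiplier (log_bessel_symbol s lam)"

text \<open>Borel representatives suffice: every Lebesgue measurable function agrees almost everywhere
  with a Borel one.\<close>

definition Lp_funs :: "ennreal \<Rightarrow> (real ^ 'n \<Rightarrow> complex) set"
  where "Lp_funs p = {h \<in> borel_measurable lborel.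
    if p = \<infinity> then \<exists>C. AE x in lborel. norm (h x) \<le> C
    else integrable lborel (\<lambda>x. norm (h x) powr enn2real p)}"

definition log_bessel_space ::
    "ennreal \<Rightarrow> real \<Rightarrow> real \<Rightarrow> ((real ^ 'n \<Rightarrow> complex) \<Rightarrow> complex) set"
  where "log_bessel_space p s lam =
    {u \<in> tempered_distributions. log_bessel_op s lam u \<in> dist_of_fun ` Lp_funs p}"

end

theory Submission
  imports Defs "HOL-Probability.Probability"
begin

text \<open>Write \<open>m\<^sub>l\<close> for the symbol \<open>(l + r)\<^sup>s ln (l + r)\<close>, where \<open>r = 4\<pi>\<^sup>2|\<xi>|\<^sup>2\<close>.

  \<^bold>\<open>Inclusion.\<close> Since \<open>m\<^sub>1 = m\<^sub>l M\<close> with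
  \<open>M = ((1 + r)/(l + r))\<^sup>s (1 - (ln (l + r) - ln (1 + r)) / ln (l + r))\<close>, it is enough that \<open>M\<close> is
  a Fourier multiplier of \<open>L\<^sup>p\<close> for every \<open>1 \<le> p \<le> \<infinity>\<close>. The Fourier transform of a finite measure is
  such a multiplier, because it acts by averaging translates. Every positive mixture of the powers
  \<open>(m + r) powr - t\<close> with \<open>m, t > 0\<close> is the Fourier transform of a finite measure as soon as it is
  finite at \<open>r = 0\<close>: by the Gamma integral each power is a mixture of the Gaussians \<open>exp (- \<tau> r)\<close>, and
  each of these is the transform of a Gaussian probability density
  (\<open>Lp_multiplier_resolvent_mixture\<close>). All factors of \<open>M\<close> are built from such mixtures:
  \<^item> \<open>1 / ln (l + r)\<close> is the integral of \<open>(l + r) powr - t\<close> over \<open>t > 0\<close>;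
  \<^item> \<open>ln (l + r) - ln (1 + r)\<close> is the integral of \<open>(m + r) powr - 1\<close> over \<open>1 \<le> m \<le> l\<close>;
  \<^item> for \<open>0 < q < 1\<close>, \<open>((1 + r)/(l + r))\<^sup>q = 1 - (l + r) powr - q * ((l + r)\<^sup>q - (1 + r)\<^sup>q)\<close>, and the
    last difference is \<open>q\<close> times the integral of \<open>(m + r) powr - (1 - q)\<close> over \<open>1 \<le> m \<le> l\<close>; an
    arbitrary \<open>s\<close> is reached by taking a power of the case \<open>q = s / N\<close>.

  \<^bold>\<open>Strictness.\<close> The Fourier transform of a coordinate function \<open>x\<^sub>i\<close> is a multiple of the
  derivative of the Dirac measure at the origin. The gradient of the radial function \<open>m\<^sub>l\<close> vanishes
  at the origin, so the operator with symbol \<open>m\<^sub>l\<close> multiplies \<open>x\<^sub>i\<close> by \<open>m\<^sub>l(0) = l\<^sup>s ln l\<close>. This is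
  \<open>0\<close> for \<open>l = 1\<close> and nonzero for \<open>l > 1\<close>, while \<open>x\<^sub>i\<close> lies in no \<open>L\<^sup>p\<close>, not even for \<open>p = \<infinity>\<close>.

  The rest of the text is the Fourier analysis that both halves rest on: multiplication by the
  symbols and the Fourier transform preserve Schwartz functions, and the inversion formula holds.\<close>

section \<open>Partial derivatives\<close>

lemma partial_deriv_eq:
  assumes "(f has_derivative D) (at x)"
  shows "partial_deriv i f x = D (axis i 1)"
  using frechet_derivative_at[OF assms] by (simp add: partial_deriv_def)

lemma has_derivative_frechet:
  "f differentiable at x \<Longrightarrow> (f has_derivative frechet_derivative f (at x)) (at x)"
  by (simp add: frechet_derivative_works)

lemma partial_deriv_add:
  assumes "f differentiable at x" "g differentiable at x"
  shows "partial_deriv i (\<lambda>x. f x + g x) x = partial_deriv i f x + partial_deriv i g x"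
  using partial_deriv_eq[OF has_derivative_add[OF has_derivative_frechet has_derivative_frechet, OF assms], of i]
  by (simp add: partial_deriv_def)

lemma partial_deriv_mult:
  assumes "f differentiable at x" "g differentiable at x"
  shows "partial_deriv i (\<lambda>x. f x * g x) x = partial_deriv i f x * g x + f x * partial_deriv i g x"
  using partial_deriv_eq[OF has_derivative_mult[OF has_derivative_frechet has_derivative_frechet, OF assms], of i]
  by (simp add: partial_deriv_def)

lemma partial_deriv_const [simp]: "partial_deriv i (\<lambda>x. c) = (\<lambda>x. 0)"
  by (rule ext) (simp add: partial_deriv_def)

section \<open>Slowly increasing symbols\<close>

text \<open>The symbol of \<open>l I - \<Delta>\<close>.\<close>

abbreviation shifted_laplace :: "real \<Rightarrow> real ^ 'n \<Rightarrow> real"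
  where "shifted_laplace l x \<equiv> l + 4 * pi\<^sup>2 * (norm x)\<^sup>2"

definition plane_wave :: "real ^ 'n \<Rightarrow> real ^ 'n \<Rightarrow> complex"
  where "plane_wave y x = exp (2 * complex_of_real pi * \<i> * complex_of_real (x \<bullet> y))"

text \<open>A concrete algebra of smooth functions of polynomial growth, just large enough to contain all
  symbols that occur below. It is generated by functions whose partial derivatives are again
  polynomials in the generators; closure under derivatives, and hence stability of the Schwartz
  space under multiplication, is then a plain induction that avoids the Leibniz rule for iterated
  derivatives.\<close>

inductive_set slow :: "(real ^ 'n \<Rightarrow> complex) set" where
  const: "(\<lambda>x. c) \<in> slow"
| coord: "(\<lambda>x. complex_of_real (x $ i)) \<in> slow"
| wave: "plane_wave y \<in> slow"
| powr: "1 \<le> l \<Longrightarrow> (\<lambda>x. complex_of_real (shifted_laplace l x powr a)) \<in> slow"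
| ln: "1 \<le> l \<Longrightarrow> (\<lambda>x. complex_of_real (ln (shifted_laplace l x))) \<in> slow"
| inv_ln: "1 < l \<Longrightarrow> (\<lambda>x. complex_of_real (1 / ln (shifted_laplace l x))) \<in> slow"
| add: "a \<in> slow \<Longrightarrow> b \<in> slow \<Longrightarrow> (\<lambda>x. a x + b x) \<in> slow"
| mult: "a \<in> slow \<Longrightarrow> b \<in> slow \<Longrightarrow> (\<lambda>x. a x * b x) \<in> slow"

lemma shifted_laplace_ge: "l \<le> shifted_laplace l x"
  by simp

lemma has_derivative_radial:
  fixes x :: "real ^ 'n"
  assumes "(\<phi> has_real_derivative d) (at (shifted_laplace l x))"
  shows "((\<lambda>x. complex_of_real (\<phi> (shifted_laplace l x))) has_derivative
    (\<lambda>h. complex_of_real (8 * pi\<^sup>2 * (x \<bullet> h) * d))) (at x)"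
proof -
  have "((\<lambda>x. shifted_laplace l x) has_derivative (\<lambda>h. 8 * pi\<^sup>2 * (x \<bullet> h))) (at x)"
    unfolding power2_norm_eq_inner by (auto intro!: derivative_eq_intros simp: inner_commute)
  from has_derivative_of_real[OF DERIV_compose_FDERIV[OF assms this]] show ?thesis
    by simp
qed

lemma has_derivative_plane_wave:
  "(plane_wave y has_derivative
    (\<lambda>h. 2 * complex_of_real pi * \<i> * complex_of_real (h \<bullet> y) * plane_wave y x)) (at x)"
proof -
  have "((\<lambda>x. 2 * complex_of_real pi * \<i> * complex_of_real (x \<bullet> y)) has_derivative
    (\<lambda>h. 2 * complex_of_real pi * \<i> * complex_of_real (h \<bullet> y))) (at x)"
    by (auto intro!: derivative_eq_intros)
  from has_derivative_compose[OF this DERIV_exp[unfolded has_field_derivative_def]] show ?thesis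
    unfolding plane_wave_def[abs_def] by (simp add: mult.commute)
qed

lemma norm_plane_wave [simp]: "norm (plane_wave y x) = 1"
proof -
  have "plane_wave y x = exp (\<i> * complex_of_real (2 * pi * (x \<bullet> y)))"
    by (simp add: plane_wave_def mult_ac)
  then show ?thesis
    by (simp only: norm_exp_i_times)
qed

text \<open>Where \<open>l \<ge> 1\<close> the argument of the powers and logarithms stays positive; the generator
  \<open>1 / ln\<close> needs \<open>l > 1\<close> so that the logarithm stays away from \<open>0\<close>.\<close>

lemma slow_differentiable: "a \<in> slow \<Longrightarrow> a differentiable at x"
proof (induction rule: slow.induct)
  case (coord i)
  have "((\<lambda>x. complex_of_real (x $ i)) has_derivative (\<lambda>h. complex_of_real (h $ i))) (at x)"
    by (intro has_derivative_of_real bounded_linear_imp_has_derivative bounded_linear_vec_nth)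
  then show ?case by (rule differentiableI)
next
  case (wave y) show ?case by (rule differentiableI[OF has_derivative_plane_wave])
next
  case (powr l a)
  then have "shifted_laplace l x > 0" using shifted_laplace_ge[of l x] by linarith
  then show ?case
    by (intro differentiableI[OF has_derivative_radial] derivative_eq_intros) auto
next
  case (ln l)
  then have "shifted_laplace l x > 0" using shifted_laplace_ge[of l x] by linarith
  then show ?case
    by (intro differentiableI[OF has_derivative_radial] derivative_eq_intros) auto
next
  case (inv_ln l)
  then have 1: "shifted_laplace l x > 1" using shifted_laplace_ge[of l x] by linarith
  then have "ln (shifted_laplace l x) \<noteq> 0" by (simp add: ln_gt_zero less_imp_neq[THEN not_sym])
  with 1 show ?case
    by (intro differentiableI[OF has_derivative_radial[where \<phi>="\<lambda>t. 1 / ln t"]] derivative_eq_intros) auto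
qed (auto)

lemma slow_partial_deriv: "a \<in> slow \<Longrightarrow> partial_deriv i a \<in> slow"
proof (induction rule: slow.induct)
  case (const c)
  show ?case by (simp add: slow.const)
next
  case (coord j)
  have "((\<lambda>x. complex_of_real (x $ j)) has_derivative (\<lambda>h. complex_of_real (h $ j))) (at x)" for x :: "real ^ 'a"
    by (intro has_derivative_of_real bounded_linear_imp_has_derivative bounded_linear_vec_nth)
  then have "partial_deriv i (\<lambda>x. complex_of_real (x $ j)) = (\<lambda>x. complex_of_real (axis i 1 $ j))"
    by (intro ext) (rule partial_deriv_eq)
  then show ?case by (simp add: slow.const)
next
  case (wave y)
  have "partial_deriv i (plane_wave y) = (\<lambda>x. (2 * complex_of_real pi * \<i> * complex_of_real (y $ i)) * plane_wave y x)"
    by (intro ext) (simp add: partial_deriv_eq[OF has_derivative_plane_wave] inner_axis' inner_commute[of y])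
  then show ?case by (simp add: slow.const slow.mult slow.wave)
next
  case (powr l a)
  have "partial_deriv i (\<lambda>x. complex_of_real (shifted_laplace l x powr a)) =
    (\<lambda>x. complex_of_real (8 * pi\<^sup>2 * a) * (complex_of_real (x $ i) * complex_of_real (shifted_laplace l x powr (a - 1))))"
  proof
    fix x :: "real ^ 'a"
    have "shifted_laplace l x > 0" using powr shifted_laplace_ge[of l x] by linarith
    then have "((\<lambda>t. t powr a) has_real_derivative a * shifted_laplace l x powr (a - 1)) (at (shifted_laplace l x))"
      by (intro derivative_eq_intros) auto
    from partial_deriv_eq[OF has_derivative_radial[OF this], of i]
    show "partial_deriv i (\<lambda>x. complex_of_real (shifted_laplace l x powr a)) x =
      complex_of_real (8 * pi\<^sup>2 * a) * (complex_of_real (x $ i) * complex_of_real (shifted_laplace l x powr (a - 1)))"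
      by (simp add: inner_axis)
  qed
  then show ?case using powr by (simp only:) (intro slow.const slow.mult slow.coord slow.powr)
next
  case (ln l)
  have "partial_deriv i (\<lambda>x. complex_of_real (ln (shifted_laplace l x))) =
    (\<lambda>x. complex_of_real (8 * pi\<^sup>2) * (complex_of_real (x $ i) * complex_of_real (shifted_laplace l x powr (-1))))"
  proof
    fix x :: "real ^ 'a"
    have pos: "shifted_laplace l x > 0" using ln shifted_laplace_ge[of l x] by linarith
    from partial_deriv_eq[OF has_derivative_radial[OF DERIV_ln[OF pos]], of i] pos
    show "partial_deriv i (\<lambda>x. complex_of_real (ln (shifted_laplace l x))) x =
      complex_of_real (8 * pi\<^sup>2) * (complex_of_real (x $ i) * complex_of_real (shifted_laplace l x powr (-1)))"
      by (simp add: inner_axis powr_minus)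
  qed
  then show ?case using ln by (simp only:) (intro slow.const slow.mult slow.coord slow.powr)
next
  case (inv_ln l)
  have "partial_deriv i (\<lambda>x. complex_of_real (1 / ln (shifted_laplace l x))) =
    (\<lambda>x. complex_of_real (- 8 * pi\<^sup>2) * (complex_of_real (x $ i) * (complex_of_real (shifted_laplace l x powr (-1)) *
      (complex_of_real (1 / ln (shifted_laplace l x)) * complex_of_real (1 / ln (shifted_laplace l x))))))"
  proof
    fix x :: "real ^ 'a"
    have pos: "shifted_laplace l x > 1" using inv_ln shifted_laplace_ge[of l x] by linarith
    then have "ln (shifted_laplace l x) \<noteq> 0" by (simp add: ln_gt_zero less_imp_neq[THEN not_sym])
    with pos have "((\<lambda>t. 1 / ln t) has_real_derivative
      - (inverse (shifted_laplace l x) * (1 / ln (shifted_laplace l x) * (1 / ln (shifted_laplace l x))))) (at (shifted_laplace l x))"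
      by (auto intro!: derivative_eq_intros simp: divide_simps)
    from partial_deriv_eq[OF has_derivative_radial[OF this], of i] pos
    show "partial_deriv i (\<lambda>x. complex_of_real (1 / ln (shifted_laplace l x))) x =
      complex_of_real (- 8 * pi\<^sup>2) * (complex_of_real (x $ i) * (complex_of_real (shifted_laplace l x powr (-1)) *
      (complex_of_real (1 / ln (shifted_laplace l x)) * complex_of_real (1 / ln (shifted_laplace l x)))))"
      by (simp add: inner_axis powr_minus)
  qed
  then show ?case using inv_ln
    by (simp only:) (intro slow.const slow.mult slow.coord slow.powr slow.inv_ln; simp)
next
  case (add a b)
  then have "partial_deriv i (\<lambda>x. a x + b x) = (\<lambda>x. partial_deriv i a x + partial_deriv i b x)"
    by (intro ext partial_deriv_add slow_differentiable)
  with add show ?case by (simp add: slow.add)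
next
  case (mult a b)
  then have "partial_deriv i (\<lambda>x. a x * b x) = (\<lambda>x. partial_deriv i a x * b x + a x * partial_deriv i b x)"
    by (intro ext partial_deriv_mult slow_differentiable)
  with mult show ?case by (simp add: slow.add slow.mult)
qed

lemma shifted_laplace_bound:
  assumes "0 \<le> l"
  shows "shifted_laplace l x \<le> (l + 4 * pi\<^sup>2) * (1 + norm x) ^ 2"
proof -
  have "1 \<le> (1 + norm x)\<^sup>2" "(norm x)\<^sup>2 \<le> (1 + norm x)\<^sup>2"
    by (auto intro!: power_mono one_le_power)
  then have "l * 1 \<le> l * (1 + norm x)\<^sup>2"
    and "4 * pi\<^sup>2 * (norm x)\<^sup>2 \<le> 4 * pi\<^sup>2 * (1 + norm x)\<^sup>2"
    using assms by (intro mult_left_mono; simp)+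
  then show ?thesis unfolding distrib_right by linarith
qed

lemma slow_bound: "a \<in> slow \<Longrightarrow> \<exists>C\<ge>0. \<exists>k. \<forall>x. norm (a x) \<le> C * (1 + norm x) ^ k"
proof (induction rule: slow.induct)
  case (const c)
  show ?case by (intro exI[of _ "norm c"] conjI exI[of _ 0]) auto
next
  case (coord i)
  have "\<bar>x $ i\<bar> \<le> 1 + norm x" for x :: "real ^ 'a"
    using component_le_norm_cart[of x i] by linarith
  then show ?case by (intro exI[of _ 1] conjI exI[of _ 1]) auto
next
  case (wave y)
  show ?case by (intro exI[of _ 1] conjI exI[of _ 0]) auto
next
  case (powr l a)
  \<comment> \<open>The base is at least \<open>1\<close>, so the real exponent may be rounded up to a natural one.\<close>
  define N where "N = nat \<lceil>\<bar>a\<bar>\<rceil>"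
  have "norm (complex_of_real (shifted_laplace l x powr a)) \<le> (l + 4 * pi\<^sup>2) ^ N * (1 + norm x) ^ (2 * N)" for x :: "real ^ 'a"
  proof -
    have 1: "1 \<le> shifted_laplace l x" using powr shifted_laplace_ge[of l x] by linarith
    have "a \<le> real N" unfolding N_def by linarith
    then have "shifted_laplace l x powr a \<le> shifted_laplace l x powr (real N)"
      using 1 by (intro powr_mono) auto
    also have "\<dots> = shifted_laplace l x ^ N" using 1 by (intro powr_realpow) auto
    also have "\<dots> \<le> ((l + 4 * pi\<^sup>2) * (1 + norm x) ^ 2) ^ N"
      using powr 1 by (intro power_mono shifted_laplace_bound) auto
    finally show ?thesis by (simp add: power_mult_distrib power_mult)
  qed
  then show ?case using powr by (intro exI[of _ "(l + 4 * pi\<^sup>2) ^ N"] conjI exI[of _ "2 * N"]) auto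
next
  case (ln l)
  have "norm (complex_of_real (ln (shifted_laplace l x))) \<le> (l + 4 * pi\<^sup>2) * (1 + norm x) ^ 2" for x :: "real ^ 'a"
  proof -
    have 1: "1 \<le> shifted_laplace l x" using ln shifted_laplace_ge[of l x] by linarith
    then have "\<bar>ln (shifted_laplace l x)\<bar> = ln (shifted_laplace l x)" by simp
    also have "\<dots> \<le> shifted_laplace l x" using 1 ln_le_minus_one[of "shifted_laplace l x"] by linarith
    also have "\<dots> \<le> (l + 4 * pi\<^sup>2) * (1 + norm x) ^ 2" using ln by (intro shifted_laplace_bound) auto
    finally show ?thesis by simp
  qed
  then show ?case using ln by (intro exI[of _ "l + 4 * pi\<^sup>2"] conjI exI[of _ 2]) auto
next
  case (inv_ln l)
  have "norm (complex_of_real (1 / ln (shifted_laplace l x))) \<le> 1 / ln l * (1 + norm x) ^ 0" for x :: "real ^ 'a"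
  proof -
    have "l \<le> shifted_laplace l x" by simp
    moreover have "0 < ln l" using inv_ln by simp
    moreover have "ln l \<le> ln (shifted_laplace l x)" using inv_ln by (intro ln_mono) auto
    ultimately show ?thesis by (simp add: norm_divide divide_simps)
  qed
  then show ?case using inv_ln by (intro exI[of _ "1 / ln l"] conjI exI[of _ 0]) auto
next
  case (add a b)
  then obtain C k D m where *: "C \<ge> 0" "D \<ge> 0" "\<And>x. norm (a x) \<le> C * (1 + norm x) ^ k" "\<And>x. norm (b x) \<le> D * (1 + norm x) ^ m"
    by blast
  have "norm (a x + b x) \<le> (C + D) * (1 + norm x) ^ (k + m)" for x
  proof -
    have "norm (a x + b x) \<le> C * (1 + norm x) ^ k + D * (1 + norm x) ^ m"
      by (rule norm_triangle_le) (use *(3,4)[of x] in linarith)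
    also have "\<dots> \<le> C * (1 + norm x) ^ (k + m) + D * (1 + norm x) ^ (k + m)"
      using * by (intro add_mono mult_left_mono power_increasing) auto
    finally show ?thesis by (simp add: algebra_simps)
  qed
  with * show ?case by (intro exI[of _ "C + D"] conjI exI[of _ "k + m"]) auto
next
  case (mult a b)
  then obtain C k D m where *: "C \<ge> 0" "D \<ge> 0" "\<And>x. norm (a x) \<le> C * (1 + norm x) ^ k" "\<And>x. norm (b x) \<le> D * (1 + norm x) ^ m"
    by blast
  have "norm (a x * b x) \<le> (C * D) * (1 + norm x) ^ (k + m)" for x
    using mult_mono[OF *(3)[of x] *(4)[of x]] * by (simp add: norm_mult power_add mult_ac)
  with * show ?case by (intro exI[of _ "C * D"] conjI exI[of _ "k + m"]) auto
qed

section \<open>Schwartz functions\<close>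

definition rapidly_decreasing :: "(real ^ 'n \<Rightarrow> complex) \<Rightarrow> bool"
  where "rapidly_decreasing f \<longleftrightarrow> (\<forall>k. \<exists>C. \<forall>x. (1 + norm x) ^ k * norm (f x) \<le> C)"

lemma rapidly_decreasing_iff:
  "rapidly_decreasing f \<longleftrightarrow> (\<forall>k. bounded (range (\<lambda>x. (1 + norm x) ^ k * norm (f x))))"
proof -
  have "\<bar>(1 + norm x) ^ k * norm (f x)\<bar> = (1 + norm x) ^ k * norm (f x)" for x k
    by simp
  then show ?thesis
    unfolding rapidly_decreasing_def bounded_iff by auto
qed

lemma schwartz_iff:
  "f \<in> schwartz \<longleftrightarrow> (\<forall>is. (\<forall>x. iter_partial is f differentiable at x) \<and> rapidly_decreasing (iter_partial is f))"
  by (auto simp: schwartz_def smooth_def rapidly_decreasing_iff)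

lemma schwartz_differentiable: "f \<in> schwartz \<Longrightarrow> f differentiable at x"
  by (metis schwartz_iff iter_partial.simps(1))

lemma schwartz_rapidly_decreasing: "f \<in> schwartz \<Longrightarrow> rapidly_decreasing f"
  by (metis schwartz_iff iter_partial.simps(1))

lemma schwartz_partial_deriv: "f \<in> schwartz \<Longrightarrow> partial_deriv i f \<in> schwartz"
proof -
  have *: "iter_partial is (partial_deriv i f) = iter_partial (is @ [i]) f" for "is"
    by (induction "is") auto
  assume "f \<in> schwartz"
  then show ?thesis unfolding schwartz_iff * by blast
qed

text \<open>Partial derivatives of products are sums of products. Closing a set under finite sums lets the
  coinduction principle below be applied to the set of products itself.\<close>

inductive_set additive_hull :: "(real ^ 'n \<Rightarrow> complex) set \<Rightarrow> (real ^ 'n \<Rightarrow> complex) set" for S where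
  base: "f \<in> S \<Longrightarrow> f \<in> additive_hull S"
| add: "f \<in> additive_hull S \<Longrightarrow> g \<in> additive_hull S \<Longrightarrow> (\<lambda>x. f x + g x) \<in> additive_hull S"

text \<open>Schwartz functions form the largest set of differentiable, rapidly decreasing functions that is
  stable under partial derivatives, so membership can be proved by exhibiting any such set. The
  derivatives only have to stay in the set up to finite sums.\<close>

lemma schwartz_coinduct:
  assumes diff: "\<And>f x. f \<in> S \<Longrightarrow> f differentiable at x"
    and rapid: "\<And>f. f \<in> S \<Longrightarrow> rapidly_decreasing f"
    and partial: "\<And>f i. f \<in> S \<Longrightarrow> partial_deriv i f \<in> additive_hull S"
  shows "additive_hull S \<subseteq> schwartz"
proof
  fix f assume f: "f \<in> additive_hull S"
  have d: "g differentiable at x" if "g \<in> additive_hull S" for g x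
    using that by induction (auto intro: diff)
  have r: "rapidly_decreasing g" if "g \<in> additive_hull S" for g
    using that
  proof induction
    case (add f g)
    show ?case unfolding rapidly_decreasing_def
    proof
      fix k
      from add obtain C D where *: "\<And>x. (1 + norm x) ^ k * norm (f x) \<le> C" "\<And>x. (1 + norm x) ^ k * norm (g x) \<le> D"
        unfolding rapidly_decreasing_def by meson
      have "(1 + norm x) ^ k * norm (f x + g x) \<le> C + D" for x
      proof -
        have "(1 + norm x) ^ k * norm (f x + g x) \<le> (1 + norm x) ^ k * (norm (f x) + norm (g x))"
          by (intro mult_left_mono norm_triangle_ineq) auto
        then show ?thesis using *[of x] by (simp add: algebra_simps)
      qed
      then show "\<exists>C. \<forall>x. (1 + norm x) ^ k * norm (f x + g x) \<le> C" by blast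
    qed
  qed (rule rapid)
  have p: "partial_deriv i g \<in> additive_hull S" if "g \<in> additive_hull S" for g i
    using that
  proof induction
    case (add f g)
    then have "partial_deriv i (\<lambda>x. f x + g x) = (\<lambda>x. partial_deriv i f x + partial_deriv i g x)"
      by (intro ext partial_deriv_add d)
    with add show ?case by (simp add: additive_hull.add)
  qed (rule partial)
  have "iter_partial is f \<in> additive_hull S" for "is"
    by (induction "is") (auto simp: f intro: p)
  then show "f \<in> schwartz"
    unfolding schwartz_iff using d r by blast
qed

lemma schwartz_add:
  assumes "f \<in> schwartz" "g \<in> schwartz"
  shows "(\<lambda>x. f x + g x) \<in> schwartz"
proof -
  have "additive_hull schwartz \<subseteq> schwartz"
    by (rule schwartz_coinduct)
       (auto intro: schwartz_differentiable schwartz_rapidly_decreasing schwartz_partial_deriv additive_hull.base)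
  then show ?thesis
    by (rule subsetD) (intro additive_hull.add additive_hull.base assms)
qed

lemma rapidly_decreasing_mult_slow:
  assumes f: "rapidly_decreasing f" and a: "\<And>x. norm (a x) \<le> C * (1 + norm x) ^ m"
  shows "rapidly_decreasing (\<lambda>x. a x * f x)"
  unfolding rapidly_decreasing_def
proof
  fix k
  have "0 \<le> C" using order_trans[OF norm_ge_zero a[of 0]] by simp
  from f obtain D where D: "\<And>x. (1 + norm x) ^ (k + m) * norm (f x) \<le> D"
    unfolding rapidly_decreasing_def by blast
  have "(1 + norm x) ^ k * norm (a x * f x) \<le> C * D" for x
  proof -
    have "(1 + norm x) ^ k * norm (a x * f x) \<le> (1 + norm x) ^ k * ((C * (1 + norm x) ^ m) * norm (f x))"
      unfolding norm_mult by (intro mult_left_mono mult_right_mono a) auto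
    also have "\<dots> = C * ((1 + norm x) ^ (k + m) * norm (f x))" by (simp add: power_add mult_ac)
    also have "\<dots> \<le> C * D" using D \<open>0 \<le> C\<close> by (intro mult_left_mono) auto
    finally show ?thesis .
  qed
  then show "\<exists>C. \<forall>x. (1 + norm x) ^ k * norm (a x * f x) \<le> C" by blast
qed

lemma schwartz_slow_mult:
  assumes "a \<in> slow" "f \<in> schwartz"
  shows "(\<lambda>x. a x * f x) \<in> schwartz"
proof -
  define S :: "(real ^ 'a \<Rightarrow> complex) set" where "S = {\<lambda>x. a x * f x |a f. a \<in> slow \<and> f \<in> schwartz}"
  have "additive_hull S \<subseteq> schwartz"
  proof (rule schwartz_coinduct)
    fix g assume "g \<in> S"
    then obtain a f where g: "g = (\<lambda>x. a x * f x)" and a: "a \<in> slow" and f: "f \<in> schwartz"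
      by (auto simp: S_def)
    show "g differentiable at x" for x
      unfolding g using a f by (intro differentiable_mult slow_differentiable schwartz_differentiable)
    from slow_bound[OF a] show "rapidly_decreasing g"
      unfolding g using rapidly_decreasing_mult_slow[OF schwartz_rapidly_decreasing[OF f]] by blast
    fix i
    have "partial_deriv i g = (\<lambda>x. partial_deriv i a x * f x + a x * partial_deriv i f x)"
      unfolding g using a f by (intro ext partial_deriv_mult slow_differentiable schwartz_differentiable)
    moreover have "(\<lambda>x. partial_deriv i a x * f x) \<in> S" "(\<lambda>x. a x * partial_deriv i f x) \<in> S"
      unfolding S_def using a f slow_partial_deriv schwartz_partial_deriv by blast+
    ultimately show "partial_deriv i g \<in> additive_hull S"
      by (simp add: additive_hull.intros)
  qed
  then show ?thesis using assms by (auto intro!: additive_hull.base simp: S_def)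
qed

lemma schwartz_cmult: "f \<in> schwartz \<Longrightarrow> (\<lambda>x. c * f x) \<in> schwartz"
  by (rule schwartz_slow_mult[OF slow.const])

lemma schwartz_diff:
  assumes "f \<in> schwartz" "g \<in> schwartz"
  shows "(\<lambda>x. f x - g x) \<in> schwartz"
  using schwartz_add[OF assms(1) schwartz_cmult[OF assms(2), of "-1"]] by simp

text \<open>Covers both translations and the reflection that exchanges the Fourier transform with its inverse.\<close>

lemma schwartz_isometry:
  assumes f: "f \<in> schwartz" and c: "\<bar>c\<bar> = 1"
  shows "(\<lambda>x. f (t + c *\<^sub>R x)) \<in> schwartz"
proof -
  define S :: "(real ^ 'a \<Rightarrow> complex) set" where "S = {\<lambda>x. f (t + c *\<^sub>R x) |f. f \<in> schwartz}"
  have "additive_hull S \<subseteq> schwartz"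
  proof (rule schwartz_coinduct)
    fix g assume "g \<in> S"
    then obtain f where g: "g = (\<lambda>x. f (t + c *\<^sub>R x))" and f: "f \<in> schwartz"
      by (auto simp: S_def)
    have D: "(g has_derivative (\<lambda>h. frechet_derivative f (at (t + c *\<^sub>R x)) (c *\<^sub>R h))) (at x)" for x
    proof -
      have "((\<lambda>x. t + c *\<^sub>R x) has_derivative (\<lambda>h. c *\<^sub>R h)) (at x)"
        by (auto intro!: derivative_eq_intros)
      from has_derivative_compose[OF this has_derivative_frechet[OF schwartz_differentiable[OF f]]]
      show ?thesis unfolding g .
    qed
    show "g differentiable at x" for x using D by (rule differentiableI)
    have "linear (frechet_derivative f (at y))" for y
      using has_derivative_frechet[OF schwartz_differentiable[OF f]] by (rule has_derivative_linear)
    then have "partial_deriv i g = (\<lambda>x. complex_of_real c * partial_deriv i f (t + c *\<^sub>R x))" for i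
      by (intro ext) (simp add: partial_deriv_eq[OF D], simp add: partial_deriv_def linear_cmul scaleR_conv_of_real[where 'a=complex])
    then show "partial_deriv i g \<in> additive_hull S" for i
      using schwartz_cmult[OF schwartz_partial_deriv[OF f], of "complex_of_real c"]
      by (auto intro!: additive_hull.base simp: S_def)
    show "rapidly_decreasing g"
      unfolding rapidly_decreasing_def
    proof
      fix k
      from schwartz_rapidly_decreasing[OF f] obtain D where D: "\<And>x. (1 + norm x) ^ k * norm (f x) \<le> D"
        unfolding rapidly_decreasing_def by blast
      have "(1 + norm x) ^ k * norm (g x) \<le> (1 + norm t) ^ k * D" for x
      proof -
        have "norm x = norm ((t + c *\<^sub>R x) - t)" using c by simp
        also have "\<dots> \<le> norm (t + c *\<^sub>R x) + norm t" by (rule norm_triangle_ineq4)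
        finally have "1 + norm x \<le> 1 + norm t + norm (t + c *\<^sub>R x)" by simp
        also have "\<dots> \<le> (1 + norm t) * (1 + norm (t + c *\<^sub>R x))" by (simp add: algebra_simps)
        finally have "(1 + norm x) ^ k \<le> ((1 + norm t) * (1 + norm (t + c *\<^sub>R x))) ^ k"
          by (intro power_mono) auto
        then have "(1 + norm x) ^ k * norm (g x) \<le> ((1 + norm t) * (1 + norm (t + c *\<^sub>R x))) ^ k * norm (f (t + c *\<^sub>R x))"
          unfolding g by (intro mult_right_mono) auto
        also have "\<dots> = (1 + norm t) ^ k * ((1 + norm (t + c *\<^sub>R x)) ^ k * norm (f (t + c *\<^sub>R x)))"
          by (simp add: power_mult_distrib)
        also have "\<dots> \<le> (1 + norm t) ^ k * D" by (intro mult_left_mono D) auto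
        finally show ?thesis .
      qed
      then show "\<exists>C. \<forall>x. (1 + norm x) ^ k * norm (g x) \<le> C" by blast
    qed
  qed
  then show ?thesis using f by (auto intro!: additive_hull.base simp: S_def)
qed

lemma schwartz_uminus: "f \<in> schwartz \<Longrightarrow> (\<lambda>x. f (- x)) \<in> schwartz"
  using schwartz_isometry[of f "-1" 0] by simp

definition gauss :: "real ^ 'n \<Rightarrow> complex"
  where "gauss x = complex_of_real (exp (- pi * (norm x)\<^sup>2))"

lemma rapidly_decreasing_gauss: "rapidly_decreasing gauss"
  unfolding rapidly_decreasing_def
proof
  fix k
  have "(1 + norm x) ^ k * norm (gauss x) \<le> 2 ^ k * (fact k * exp 1)" for x :: "real ^ 'a"
  proof -
    let ?r = "(norm x)\<^sup>2"
    have "(1 + norm x) ^ k \<le> (1 + norm x) ^ (2 * k)" by (rule power_increasing) auto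
    also have "\<dots> = ((1 + norm x)\<^sup>2) ^ k" by (simp add: power_mult)
    also have "\<dots> \<le> (2 * (1 + ?r)) ^ k"
      using zero_le_power2[of "norm x - 1"]
      by (intro power_mono) (auto simp: power2_eq_square algebra_simps)
    also have "\<dots> = 2 ^ k * (1 + ?r) ^ k" by (rule power_mult_distrib)
    also have "(1 + ?r) ^ k \<le> fact k * exp (1 + ?r)"
    proof -
      have "(1 + ?r) ^ k /\<^sub>R fact k \<le> (\<Sum>n. (1 + ?r) ^ n /\<^sub>R fact n)"
        using sum_le_suminf[OF summable_exp_generic[of "1 + ?r"], of "{k}"] by simp
      then have "(1 + ?r) ^ k / fact k \<le> exp (1 + ?r)" by (simp add: exp_def divide_inverse mult_ac)
      then show ?thesis by (simp add: field_simps)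
    qed
    finally have "(1 + norm x) ^ k * norm (gauss x) \<le> 2 ^ k * (fact k * exp (1 + ?r)) * exp (- pi * ?r)"
      by (simp add: gauss_def mult_right_mono)
    also have "\<dots> = 2 ^ k * fact k * exp ((1 + ?r) + (- pi * ?r))" by (simp only: exp_add mult_ac)
    also have "\<dots> \<le> 2 ^ k * fact k * exp 1"
    proof -
      have "1 * ?r \<le> pi * ?r" using pi_gt3 by (intro mult_right_mono) auto
      then show ?thesis by simp
    qed
    finally show ?thesis by (simp add: mult_ac)
  qed
  then show "\<exists>C. \<forall>x::real^'a. (1 + norm x) ^ k * norm (gauss x) \<le> C" by blast
qed

lemma has_derivative_gauss:
  "(gauss has_derivative (\<lambda>h. complex_of_real (- 2 * pi * (x \<bullet> h)) * gauss x)) (at x)"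
proof -
  have "((\<lambda>x. exp (- pi * (norm x)\<^sup>2)) has_derivative (\<lambda>h. - 2 * pi * (x \<bullet> h) * exp (- pi * (norm x)\<^sup>2))) (at x)"
    unfolding power2_norm_eq_inner by (auto intro!: derivative_eq_intros simp: inner_commute)
  from has_derivative_of_real[OF this] show ?thesis
    unfolding gauss_def[abs_def] of_real_mult .
qed

lemma schwartz_gauss: "gauss \<in> schwartz"
proof -
  define S :: "(real ^ 'a \<Rightarrow> complex) set" where "S = {\<lambda>x. a x * gauss x |a. a \<in> slow}"
  have "additive_hull S \<subseteq> schwartz"
  proof (rule schwartz_coinduct)
    fix g assume "g \<in> S"
    then obtain a where g: "g = (\<lambda>x. a x * gauss x)" and a: "a \<in> slow"
      by (auto simp: S_def)
    have d: "gauss differentiable at x" for x :: "real ^ 'a"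
      using has_derivative_gauss by (rule differentiableI)
    show "g differentiable at x" for x
      unfolding g by (intro differentiable_mult slow_differentiable[OF a] d)
    from slow_bound[OF a] show "rapidly_decreasing g"
      unfolding g using rapidly_decreasing_mult_slow[OF rapidly_decreasing_gauss] by blast
    fix i
    have "partial_deriv i g = (\<lambda>x. (partial_deriv i a x + a x * (complex_of_real (- 2 * pi) * complex_of_real (x $ i))) * gauss x)"
      unfolding g using a d
      by (intro ext) (subst partial_deriv_mult[OF slow_differentiable[OF a] d],
        simp add: partial_deriv_eq[OF has_derivative_gauss] inner_axis, simp add: algebra_simps)
    moreover have "(\<lambda>x. partial_deriv i a x + a x * (complex_of_real (- 2 * pi) * complex_of_real (x $ i))) \<in> slow"
      using a by (intro slow.add slow.mult slow.const slow.coord slow_partial_deriv)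
    ultimately show "partial_deriv i g \<in> additive_hull S"
      by (auto intro!: additive_hull.base simp: S_def)
  qed
  moreover have "(\<lambda>x. 1 * gauss x) \<in> S" unfolding S_def by (rule CollectI, rule exI[of _ "\<lambda>x. 1"]) (simp add: slow.const)
  ultimately show ?thesis by (auto intro: additive_hull.base)
qed

section \<open>Integration over coordinate space\<close>

text \<open>Lebesgue measure is the product measure over the standard basis, whose elements are indexed by
  the coordinates.\<close>

lemma
  fixes f :: "'n::finite \<Rightarrow> real \<Rightarrow> 'a::{real_normed_field, banach, second_countable_topology}"
  assumes f: "\<And>i. integrable lborel (f i)"
  shows integrable_prod_coordinates: "integrable lborel (\<lambda>x::real^'n. \<Prod>i\<in>UNIV. f i (x $ i))" (is ?int)
    and integral_prod_coordinates:
      "(LINT x|lborel. (\<Prod>i\<in>UNIV. f i ((x::real^'n) $ i))) = (\<Prod>i\<in>UNIV. (LINT t|lborel. f i t))" (is ?eq)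
proof -
  let ?M = "\<Pi>\<^sub>M b\<in>(Basis :: (real^'n) set). (lborel :: real measure)"
  let ?T = "\<lambda>F. \<Sum>b\<in>(Basis :: (real^'n) set). F b *\<^sub>R b"
  define e :: "'n \<Rightarrow> real^'n" where "e = (\<lambda>i. axis i 1)"
  have inj: "inj e" by (auto simp: inj_on_def e_def axis_eq_axis)
  have basis: "Basis = range e" by (auto simp: Basis_vec_def e_def)
  interpret product_sigma_finite "\<lambda>_ :: real^'n. lborel :: real measure"
    by standard
  have meas: "?T \<in> ?M \<rightarrow>\<^sub>M borel" by measurable
  define G where "G x = (\<Prod>i\<in>UNIV. f i (x $ i))" for x :: "real^'n"
  have [measurable]: "G \<in> borel_measurable borel"
  proof -
    have [measurable]: "f i \<in> borel_measurable borel" for i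
      using borel_measurable_integrable[OF f, of i] by simp
    have [measurable]: "(\<lambda>x::real^'n. x $ i) \<in> borel_measurable borel" for i
      by (intro borel_measurable_continuous_onI continuous_intros)
    show ?thesis unfolding G_def[abs_def] by measurable
  qed
  have coord: "?T F $ i = F (e i)" for F i
  proof -
    have "?T F $ i = ?T F \<bullet> e i" by (simp add: inner_axis e_def)
    also have "\<dots> = F (e i)" using basis by (intro inner_sum_left_Basis) auto
    finally show ?thesis .
  qed
  have eq: "G (?T F) = (\<Prod>b\<in>Basis. f (inv e b) (F b))" for F
    unfolding G_def coord unfolding basis using inj by (subst prod.reindex) auto
  have "integrable ?M (\<lambda>F. \<Prod>b\<in>Basis. f (inv e b) (F b))"
    by (intro product_integrable_prod f) simp
  then show ?int
    unfolding G_def[symmetric]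
    by (subst lborel_eq, subst integrable_distr_eq[OF meas]) (simp_all only: eq, measurable)
  have "(LINT F|?M. (\<Prod>b\<in>Basis. f (inv e b) (F b))) = (\<Prod>b\<in>Basis. (LINT t|lborel. f (inv e b) t))"
    by (intro product_integral_prod f) simp
  also have "\<dots> = (\<Prod>i\<in>UNIV. (LINT t|lborel. f i t))"
    unfolding basis using inj by (subst prod.reindex) auto
  finally show ?eq
    unfolding G_def[symmetric]
    by (subst lborel_eq, subst integral_distr[OF meas]) (simp_all only: eq, measurable)
qed

text \<open>Comparison with the product of the one-dimensional densities \<open>1 / (1 + t\<^sup>2)\<close>, each of whose
  factors costs two powers of \<open>1 + norm x\<close>.\<close>

lemma integrable_decay: "integrable lborel (\<lambda>x::real^'n. 1 / (1 + norm x) ^ (2 * CARD('n)))"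
proof (rule Bochner_Integration.integrable_bound)
  have "integrable lborel (\<lambda>t::real. inverse (1 + t\<^sup>2))"
    using integrable_inverse_1_plus_square by (simp add: set_integrable_def)
  then show "integrable lborel (\<lambda>x::real^'n. \<Prod>i\<in>UNIV. inverse (1 + (x $ i)\<^sup>2))"
    by (rule integrable_prod_coordinates)
  show "AE x::real^'n in lborel. norm (1 / (1 + norm x) ^ (2 * CARD('n))) \<le> norm (\<Prod>i\<in>UNIV. inverse (1 + (x $ i)\<^sup>2))"
  proof (rule AE_I2)
    fix x :: "real^'n"
    have "1 + (x $ i)\<^sup>2 \<le> (1 + norm x)\<^sup>2" for i
    proof -
      have "(x $ i)\<^sup>2 \<le> (norm x)\<^sup>2"
        using component_le_norm_cart[of x i] by (metis abs_norm_cancel power2_le_iff_abs_le norm_ge_zero)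
      moreover have "0 \<le> norm x * 2" by simp
      ultimately show ?thesis unfolding power2_sum one_power2 by linarith
    qed
    then have "(\<Prod>i\<in>(UNIV::'n set). inverse ((1 + norm x)\<^sup>2)) \<le> (\<Prod>i\<in>UNIV. inverse (1 + (x $ i)\<^sup>2))"
      by (intro prod_mono conjI le_imp_inverse_le) (auto intro: add_pos_nonneg)
    moreover have "0 \<le> (\<Prod>i\<in>UNIV. inverse (1 + (x $ i)\<^sup>2))" by (intro prod_nonneg) auto
    ultimately show "norm (1 / (1 + norm x) ^ (2 * CARD('n))) \<le> norm (\<Prod>i\<in>UNIV. inverse (1 + (x $ i)\<^sup>2))"
      by (simp add: power_mult power_inverse divide_inverse)
  qed
qed simp

lemma schwartz_continuous: "f \<in> schwartz \<Longrightarrow> continuous_on A f"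
  using schwartz_differentiable differentiable_imp_continuous_within
  by (metis continuous_at_imp_continuous_on)

lemma schwartz_measurable [measurable_dest]: "f \<in> schwartz \<Longrightarrow> f \<in> borel_measurable borel"
  by (intro borel_measurable_continuous_onI schwartz_continuous)

lemma decay_bound:
  fixes f :: "real^'n \<Rightarrow> complex"
  assumes "rapidly_decreasing f"
  obtains C where "C \<ge> 0" "\<And>x. (1 + norm x) ^ m * norm (f x) \<le> C * (1 / (1 + norm x) ^ (2 * CARD('n)))"
proof -
  from assms obtain C where C: "\<And>x. (1 + norm x) ^ (m + 2 * CARD('n)) * norm (f x) \<le> C"
    unfolding rapidly_decreasing_def by blast
  have "0 \<le> C" by (rule order_trans[OF _ C[of 0]]) simp
  moreover have "(1 + norm x) ^ m * norm (f x) \<le> C * (1 / (1 + norm x) ^ (2 * CARD('n)))" for x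
  proof -
    have "(1 + norm x) ^ (2 * CARD('n)) > 0" by (simp add: add_pos_nonneg)
    then show ?thesis using C[of x] by (simp add: power_add pos_le_divide_eq mult_ac)
  qed
  ultimately show ?thesis using that by blast
qed

lemma schwartz_bounded:
  assumes "f \<in> schwartz"
  obtains C where "C \<ge> 0" "\<And>x. norm (f x) \<le> C"
proof -
  from schwartz_rapidly_decreasing[OF assms] obtain C where C: "\<And>x. (1 + norm x) ^ 0 * norm (f x) \<le> C"
    unfolding rapidly_decreasing_def by blast
  have "0 \<le> C" by (rule order_trans[OF _ C[of 0]]) simp
  with C show ?thesis using that by simp
qed

lemma integrable_schwartz_weighted:
  assumes f: "f \<in> schwartz"
  shows "integrable lborel (\<lambda>x. (1 + norm x) ^ m * norm (f x))"
proof -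
  obtain C where C: "C \<ge> 0" "\<And>x. (1 + norm x) ^ m * norm (f x) \<le> C * (1 / (1 + norm x) ^ (2 * CARD('a)))"
    using decay_bound[OF schwartz_rapidly_decreasing[OF f]] by metis
  show ?thesis
  proof (rule Bochner_Integration.integrable_bound)
    show "integrable lborel (\<lambda>x::real^'a. C * (1 / (1 + norm x) ^ (2 * CARD('a))))"
      by (intro integrable_mult_right integrable_decay)
    show "AE x in lborel. norm ((1 + norm x) ^ m * norm (f x)) \<le> norm (C * (1 / (1 + norm x) ^ (2 * CARD('a))))"
      using C by (intro AE_I2) (simp add: abs_mult)
    show "(\<lambda>x. (1 + norm x) ^ m * norm (f x)) \<in> borel_measurable lborel"
      using schwartz_measurable[OF f] by simp
  qed
qed

lemma schwartz_integrable:
  assumes f: "f \<in> schwartz"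
  shows "integrable lborel f"
proof (rule Bochner_Integration.integrable_bound[OF integrable_schwartz_weighted[OF f, of 0]])
  show "f \<in> borel_measurable lborel" using schwartz_measurable[OF f] by simp
qed simp

lemma
  fixes f :: "real^'n \<Rightarrow> 'b::{banach, second_countable_topology}"
  assumes c: "c \<noteq> 0" and [measurable]: "f \<in> borel_measurable borel"
  shows integrable_affine: "integrable lborel (\<lambda>x. f (t + c *\<^sub>R x)) \<longleftrightarrow> integrable lborel f"
    and integral_affine: "(LINT x|lborel. f x) = \<bar>c\<bar> ^ CARD('n) *\<^sub>R (LINT x|lborel. f (t + c *\<^sub>R x))"
proof -
  have L: "lborel = density (distr lborel borel (\<lambda>x::real^'n. t + c *\<^sub>R x)) (\<lambda>_. ennreal (\<bar>c\<bar> ^ CARD('n)))"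
    using lborel_affine[OF c, of t] by (simp add: ennreal_power)
  show "integrable lborel (\<lambda>x. f (t + c *\<^sub>R x)) \<longleftrightarrow> integrable lborel f"
  proof -
    have "integrable lborel f \<longleftrightarrow> integrable lborel (\<lambda>x. \<bar>c\<bar> ^ CARD('n) *\<^sub>R f (t + c *\<^sub>R x))"
      by (subst L) (simp add: integrable_density integrable_distr_eq)
    moreover have "integrable lborel (\<lambda>x. f (t + c *\<^sub>R x))"
      if "integrable lborel (\<lambda>x. \<bar>c\<bar> ^ CARD('n) *\<^sub>R f (t + c *\<^sub>R x))"
      using integrable_scaleR_right[OF that, of "1 / \<bar>c\<bar> ^ CARD('n)"] c by simp
    ultimately show ?thesis using integrable_scaleR_right by blast
  qed
  show "(LINT x|lborel. f x) = \<bar>c\<bar> ^ CARD('n) *\<^sub>R (LINT x|lborel. f (t + c *\<^sub>R x))"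
    by (subst L) (simp add: integral_density integral_distr)
qed

lemma integral_translate:
  fixes f :: "real^'n \<Rightarrow> 'b::{banach, second_countable_topology}"
  assumes "f \<in> borel_measurable borel"
  shows "(LINT x|lborel. f (t + x)) = (LINT x|lborel. f x)"
  using integral_affine[OF _ assms, of 1 t] by simp

lemma integral_reflect:
  fixes f :: "real^'n \<Rightarrow> 'b::{banach, second_countable_topology}"
  assumes "f \<in> borel_measurable borel"
  shows "(LINT x|lborel. f (- x)) = (LINT x|lborel. f x)"
  using integral_affine[OF _ assms, of "-1" 0] by simp

lemma schwartz_line_derivative:
  assumes "f \<in> schwartz"
  shows "((\<lambda>t. f (x + t *\<^sub>R axis i 1)) has_vector_derivative partial_deriv i f (x + t *\<^sub>R axis i 1)) (at t)"
proof -
  have "((\<lambda>t. x + t *\<^sub>R axis i 1) has_derivative (\<lambda>s. s *\<^sub>R axis i 1)) (at t)"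
    by (auto intro!: derivative_eq_intros)
  from has_derivative_compose[OF this has_derivative_frechet[OF schwartz_differentiable[OF assms]]]
  have "((\<lambda>t. f (x + t *\<^sub>R axis i 1)) has_derivative
    (\<lambda>s. frechet_derivative f (at (x + t *\<^sub>R axis i 1)) (s *\<^sub>R axis i 1))) (at t)" .
  moreover have "linear (frechet_derivative f (at (x + t *\<^sub>R axis i 1)))"
    using has_derivative_frechet[OF schwartz_differentiable[OF assms]] by (rule has_derivative_linear)
  ultimately show ?thesis
    by (simp add: has_vector_derivative_def partial_deriv_def linear_cmul)
qed

text \<open>The integral of a difference quotient vanishes by translation invariance, and the difference
  quotients with steps at most \<open>1\<close> have a common integrable majorant. This replaces integration by
  parts in the single coordinates.\<close>

lemma integral_partial_deriv:
  fixes f :: "real^'n \<Rightarrow> complex"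
  assumes f: "f \<in> schwartz"
  shows "(LINT x|lborel. partial_deriv i f x) = 0"
proof -
  define e :: "real^'n" where "e = axis i 1"
  define q where "q n x = real (Suc n) *\<^sub>R (f (x + (1 / real (Suc n)) *\<^sub>R e) - f x)" for n x
  have norm_e: "norm e = 1" by (simp add: e_def)
  have pf: "partial_deriv i f \<in> schwartz" by (rule schwartz_partial_deriv[OF f])
  obtain C where C: "C \<ge> 0" "\<And>x. (1 + norm x) ^ 0 * norm (partial_deriv i f x) \<le> C * (1 / (1 + norm x) ^ (2 * CARD('n)))"
    using decay_bound[OF schwartz_rapidly_decreasing[OF pf]] by metis
  \<comment> \<open>Shifting by at most a unit vector changes \<open>1 + norm x\<close> at most by the factor \<open>2\<close>.\<close>
  define w where "w x = 2 ^ (2 * CARD('n)) * C * (1 / (1 + norm x) ^ (2 * CARD('n)))" for x :: "real^'n"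
  have line: "((\<lambda>t. f (x + t *\<^sub>R e)) has_vector_derivative partial_deriv i f (x + t *\<^sub>R e)) (at t)" for x t
    unfolding e_def by (rule schwartz_line_derivative[OF f])
  have pw: "norm (partial_deriv i f (x + t *\<^sub>R e)) \<le> w x" if "t \<in> {0..1}" for x t
  proof -
    have "norm x \<le> norm (x + t *\<^sub>R e) + norm (t *\<^sub>R e)"
      by (metis add_diff_cancel norm_triangle_ineq4)
    also have "\<dots> \<le> norm (x + t *\<^sub>R e) + 1" using that norm_e by simp
    finally have "norm x \<le> norm (x + t *\<^sub>R e) + 1" .
    then have "1 + norm x \<le> 2 * (1 + norm (x + t *\<^sub>R e))"
      using that norm_e norm_ge_zero[of "x + t *\<^sub>R e"] by (simp del: norm_ge_zero)
    then have "(1 + norm x) ^ (2 * CARD('n)) \<le> 2 ^ (2 * CARD('n)) * (1 + norm (x + t *\<^sub>R e)) ^ (2 * CARD('n))"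
      by (metis power_mono power_mult_distrib add_nonneg_nonneg norm_ge_zero zero_le_one)
    moreover have "(1 + norm x) ^ (2 * CARD('n)) > 0" "(1 + norm (x + t *\<^sub>R e)) ^ (2 * CARD('n)) > 0"
      by (simp_all add: add_pos_nonneg)
    ultimately have "1 / (1 + norm (x + t *\<^sub>R e)) ^ (2 * CARD('n)) \<le> 2 ^ (2 * CARD('n)) * (1 / (1 + norm x) ^ (2 * CARD('n)))"
      by (simp add: field_simps)
    from mult_left_mono[OF this C(1)] have "C * (1 / (1 + norm (x + t *\<^sub>R e)) ^ (2 * CARD('n))) \<le> w x"
      unfolding w_def by (simp only: mult_ac)
    with C(2)[of "x + t *\<^sub>R e"] show ?thesis by simp
  qed
  have bound: "norm (q n x) \<le> w x" for n x
  proof -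
    define t where "t = 1 / real (Suc n)"
    have t: "0 \<le> t" "t \<le> 1" "real (Suc n) * t = 1" by (auto simp: t_def divide_simps)
    have "norm (f (x + t *\<^sub>R e) - f (x + 0 *\<^sub>R e)) \<le> w x * norm (t - 0)"
    proof (rule differentiable_bound[where S="{0..1}" and f'="\<lambda>t s. s *\<^sub>R partial_deriv i f (x + t *\<^sub>R e)"])
      fix s :: real assume s: "s \<in> {0..1}"
      show "((\<lambda>t. f (x + t *\<^sub>R e)) has_derivative (\<lambda>r. r *\<^sub>R partial_deriv i f (x + s *\<^sub>R e))) (at s within {0..1})"
        using line has_derivative_at_withinI unfolding has_vector_derivative_def by blast
      show "onorm (\<lambda>r. r *\<^sub>R partial_deriv i f (x + s *\<^sub>R e)) \<le> w x"
        using pw[OF s, of x] by (intro onorm_le) (simp add: mult.commute mult_left_mono)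
    qed (use t in auto)
    then have "norm (f (x + t *\<^sub>R e) - f x) \<le> w x * t" using t by simp
    then have "real (Suc n) * norm (f (x + t *\<^sub>R e) - f x) \<le> real (Suc n) * (w x * t)"
      by (intro mult_left_mono) auto
    also have "\<dots> = w x" using t(3) by (metis mult.left_commute mult.right_neutral)
    finally show ?thesis unfolding q_def t_def[symmetric] by simp
  qed
  have lim: "(\<lambda>n. q n x) \<longlonglongrightarrow> partial_deriv i f x" for x
  proof -
    have "((\<lambda>t. f (x + t *\<^sub>R e)) has_vector_derivative partial_deriv i f x) (at 0)"
      using line[of x 0] by simp
    then have L: "((\<lambda>t. norm (f (x + t *\<^sub>R e) - f x - t *\<^sub>R partial_deriv i f x) / norm t) \<longlongrightarrow> 0) (at 0)"
      unfolding has_vector_derivative_def has_derivative_iff_norm by simp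
    have "filterlim (\<lambda>n. 1 / real (Suc n)) (at 0) sequentially"
      using LIMSEQ_inverse_real_of_nat by (auto simp: filterlim_at inverse_eq_divide)
    from filterlim_compose[OF L this]
    have "(\<lambda>n. norm (f (x + (1 / real (Suc n)) *\<^sub>R e) - f x - (1 / real (Suc n)) *\<^sub>R partial_deriv i f x) /
      norm (1 / real (Suc n))) \<longlonglongrightarrow> 0" .
    moreover have "norm (f (x + (1 / real (Suc n)) *\<^sub>R e) - f x - (1 / real (Suc n)) *\<^sub>R partial_deriv i f x) /
      norm (1 / real (Suc n)) = norm (q n x - partial_deriv i f x)" for n
    proof -
      have "q n x - partial_deriv i f x =
        real (Suc n) *\<^sub>R (f (x + (1 / real (Suc n)) *\<^sub>R e) - f x - (1 / real (Suc n)) *\<^sub>R partial_deriv i f x)"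
        unfolding q_def by (simp add: scaleR_diff_right del: of_nat_Suc)
      moreover have "norm (real (Suc n) *\<^sub>R z) = norm z / norm (1 / real (Suc n))" for z :: complex
        by (simp del: of_nat_Suc)
      ultimately show ?thesis by metis
    qed
    ultimately have "(\<lambda>n. norm (q n x - partial_deriv i f x)) \<longlonglongrightarrow> 0" by simp
    then show ?thesis
      by (rule LIM_zero_cancel[OF tendsto_norm_zero_cancel])
  qed
  have [measurable]: "f \<in> borel_measurable borel" "partial_deriv i f \<in> borel_measurable borel"
    using f pf by (auto intro: schwartz_measurable)
  have "(\<lambda>n. LINT x|lborel. q n x) \<longlonglongrightarrow> (LINT x|lborel. partial_deriv i f x)"
  proof (rule integral_dominated_convergence[where w=w])
    show "integrable lborel w"
      unfolding w_def[abs_def] by (intro integrable_mult_right integrable_decay)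
  qed (use lim bound in \<open>auto simp: q_def[abs_def]\<close>)
  moreover have "(LINT x|lborel. q n x) = 0" for n
  proof -
    have "integrable lborel (\<lambda>x. f ((1 / real (Suc n)) *\<^sub>R e + 1 *\<^sub>R x))"
      using schwartz_integrable[OF f] by (subst integrable_affine) auto
    then have i: "integrable lborel (\<lambda>x. f (x + (1 / real (Suc n)) *\<^sub>R e))"
      by (simp add: add.commute)
    have "(LINT x|lborel. f (x + (1 / real (Suc n)) *\<^sub>R e)) = (LINT x|lborel. f x)"
      using integral_translate[of f "(1 / real (Suc n)) *\<^sub>R e"] by (simp add: add.commute)
    then show ?thesis
      unfolding q_def by (simp add: i schwartz_integrable[OF f] del: of_nat_Suc)
  qed
  ultimately show ?thesis
    by (simp add: LIMSEQ_const_iff)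
qed

section \<open>The Fourier transform of Schwartz functions\<close>

lemma plane_wave_commute: "plane_wave y x = plane_wave x y"
  by (simp add: plane_wave_def inner_commute)

lemma plane_wave_add: "plane_wave (y + z) x = plane_wave y x * plane_wave z x"
  by (simp add: plane_wave_def inner_right_distrib algebra_simps exp_add)

lemma plane_wave_0 [simp]: "plane_wave 0 x = 1"
  by (simp add: plane_wave_def)

lemma plane_wave_measurable [measurable]: "plane_wave y \<in> borel_measurable borel"
  unfolding plane_wave_def[abs_def] by (intro borel_measurable_continuous_onI continuous_intros)

lemma fourier_eq: "fourier f y = (LINT x|lborel. f x * plane_wave (- y) x)"
  by (simp add: fourier_def plane_wave_def)

lemma inv_fourier_eq: "inv_fourier f y = (LINT x|lborel. f x * plane_wave y x)"
  by (simp add: inv_fourier_def plane_wave_def inner_commute)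

lemma inv_fourier_uminus: "inv_fourier f y = fourier f (- y)"
  by (simp add: fourier_eq inv_fourier_eq)

lemma inv_fourier_reflect:
  assumes [measurable]: "f \<in> borel_measurable borel"
  shows "inv_fourier f = fourier (\<lambda>x. f (- x))"
proof
  fix y
  have "fourier (\<lambda>x. f (- x)) y = (LINT x|lborel. (\<lambda>x. f x * plane_wave y x) (- x))"
    by (simp add: fourier_eq plane_wave_def)
  also have "\<dots> = inv_fourier f y"
    by (subst integral_reflect) (simp_all add: inv_fourier_eq)
  finally show "inv_fourier f y = fourier (\<lambda>x. f (- x)) y" by simp
qed

lemma integrable_plane_wave:
  assumes "integrable lborel f"
  shows "integrable lborel (\<lambda>x. f x * plane_wave y x)"
proof (rule Bochner_Integration.integrable_bound[OF assms])
  show "(\<lambda>x. f x * plane_wave y x) \<in> borel_measurable lborel"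
    using borel_measurable_integrable[OF assms] by simp
qed (simp add: norm_mult)

lemma has_derivative_quadratic:
  fixes f :: "'a::real_normed_vector \<Rightarrow> 'b::real_normed_vector"
  assumes D: "bounded_linear D" and K: "\<And>y. norm (f y - f x - D (y - x)) \<le> K * (norm (y - x))\<^sup>2"
  shows "(f has_derivative D) (at x)"
proof (rule has_derivativeI_sandwich[where e=1 and H="\<lambda>y. K * norm (y - x)"])
  show "bounded_linear D" by fact
  have "((\<lambda>y. K * norm (y - x)) \<longlongrightarrow> K * norm (x - x)) (at x)"
    by (intro tendsto_intros)
  then show "((\<lambda>y. K * norm (y - x)) \<longlongrightarrow> 0) (at x)" by simp
  fix y assume "y \<noteq> x"
  then show "norm (f y - f x - D (y - x)) / norm (y - x) \<le> K * norm (y - x)"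
    using K[of y] by (simp add: divide_le_eq power2_eq_square mult.assoc)
qed simp

text \<open>Differentiation under the integral sign in Frechet form: since
  \<open>|exp (\<i>\<theta>) - 1 - \<i>\<theta>| \<le> \<theta>\<^sup>2 / 2\<close>, the remainder is bounded by a second moment of \<open>f\<close> times
  the square of the increment.\<close>

lemma fourier_has_derivative:
  fixes f :: "real^'n \<Rightarrow> complex"
  assumes f: "f \<in> schwartz"
  shows "(fourier f has_derivative (\<lambda>h. \<Sum>i\<in>UNIV. complex_of_real (h $ i) *
    fourier (\<lambda>x. - 2 * complex_of_real pi * \<i> * complex_of_real (x $ i) * f x) \<xi>)) (at \<xi>)"
proof (rule has_derivative_quadratic[where K="2 * pi\<^sup>2 * (LINT x|lborel. (1 + norm x) ^ 2 * norm (f x))"])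
  let ?g = "\<lambda>i x. - 2 * complex_of_real pi * \<i> * complex_of_real (x $ i) * f x"
  have g: "?g i \<in> schwartz" for i
    using f by (intro schwartz_slow_mult slow.mult slow.const slow.coord)
  have [measurable]: "f \<in> borel_measurable borel" using f by (rule schwartz_measurable)
  have "linear (\<lambda>h::real^'n. \<Sum>i\<in>UNIV. complex_of_real (h $ i) * fourier (?g i) \<xi>)"
    by (rule linearI)
       (simp_all add: sum.distrib distrib_right scaleR_conv_of_real[where 'a=complex] sum_distrib_left mult.assoc)
  then show "bounded_linear (\<lambda>h::real^'n. \<Sum>i\<in>UNIV. complex_of_real (h $ i) * fourier (?g i) \<xi>)"
    by (rule linear_conv_bounded_linear[THEN iffD1])
  fix y :: "real^'n"
  define h where "h = y - \<xi>"
  define r where "r x = f x * plane_wave (- \<xi>) x * (exp (\<i> * complex_of_real (- 2 * pi * (x \<bullet> h))) - (1 + \<i> * complex_of_real (- 2 * pi * (x \<bullet> h))))" for x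
  have r: "r x = f x * plane_wave (- y) x - f x * plane_wave (- \<xi>) x -
      (\<Sum>i\<in>UNIV. complex_of_real (h $ i) * (?g i x * plane_wave (- \<xi>) x))" for x
  proof -
    have "- y = - \<xi> + - h" by (simp add: h_def)
    then have "plane_wave (- y) x = plane_wave (- \<xi>) x * plane_wave (- h) x"
      by (metis plane_wave_add)
    moreover have "plane_wave (- h) x = exp (\<i> * complex_of_real (- 2 * pi * (x \<bullet> h)))"
      by (simp add: plane_wave_def mult_ac)
    moreover have "(\<Sum>i\<in>UNIV. complex_of_real (h $ i) * (?g i x * plane_wave (- \<xi>) x)) =
      f x * plane_wave (- \<xi>) x * (\<i> * complex_of_real (- 2 * pi * (x \<bullet> h)))"
      unfolding inner_vec_def by (simp add: sum_distrib_left sum_distrib_right sum_negf mult_ac)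
    ultimately show ?thesis by (simp add: r_def algebra_simps)
  qed
  have int: "integrable lborel (\<lambda>x. f x * plane_wave z x)" "integrable lborel (\<lambda>x. ?g i x * plane_wave z x)" for z i
    using f g by (intro integrable_plane_wave schwartz_integrable; simp)+
  have "(LINT x|lborel. r x) = fourier f y - fourier f \<xi> - (\<Sum>i\<in>UNIV. complex_of_real ((y - \<xi>) $ i) * fourier (?g i) \<xi>)"
    unfolding r fourier_eq h_def[symmetric] using int
    by (simp add: integral_sum integrable_sum del: mult_minus_left)
  moreover have "norm (LINT x|lborel. r x) \<le> (LINT x|lborel. 2 * pi\<^sup>2 * (norm h)\<^sup>2 * ((1 + norm x) ^ 2 * norm (f x)))"
  proof (rule order_trans[OF integral_norm_bound], rule integral_mono)
    show "integrable lborel (\<lambda>x. norm (r x))"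
      unfolding r using int
      by (intro integrable_norm Bochner_Integration.integrable_diff Bochner_Integration.integrable_sum integrable_mult_right)
    show "integrable lborel (\<lambda>x. 2 * pi\<^sup>2 * (norm h)\<^sup>2 * ((1 + norm x) ^ 2 * norm (f x)))"
      by (intro integrable_mult_right integrable_schwartz_weighted f)
    fix x
    have "\<bar>x \<bullet> h\<bar> \<le> (1 + norm x) * norm h"
      using Cauchy_Schwarz_ineq2[of x h] by (simp add: algebra_simps add_increasing)
    then have "(x \<bullet> h)\<^sup>2 \<le> ((1 + norm x) * norm h)\<^sup>2"
      by (metis abs_le_square_iff abs_of_nonneg mult_nonneg_nonneg norm_ge_zero add_nonneg_nonneg zero_le_one)
    then have b: "(- 2 * pi * (x \<bullet> h))\<^sup>2 / 2 \<le> 2 * pi\<^sup>2 * (norm h)\<^sup>2 * (1 + norm x)\<^sup>2"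
      by (simp add: power_mult_distrib mult_ac)
    have iexp: "norm (exp (\<i> * complex_of_real t) - (1 + \<i> * complex_of_real t)) \<le> t\<^sup>2 / 2" for t
      using iexp_approx1[of t 1] by (simp add: numeral_2_eq_2)
    have "norm (r x) \<le> norm (f x) * ((- 2 * pi * (x \<bullet> h))\<^sup>2 / 2)"
      unfolding r_def norm_mult norm_plane_wave mult_1_right by (intro mult_left_mono iexp) simp
    also have "\<dots> \<le> norm (f x) * (2 * pi\<^sup>2 * (norm h)\<^sup>2 * (1 + norm x)\<^sup>2)"
      by (rule mult_left_mono[OF b]) simp
    finally show "norm (r x) \<le> 2 * pi\<^sup>2 * (norm h)\<^sup>2 * ((1 + norm x) ^ 2 * norm (f x))"
      by (simp add: mult_ac)
  qed
  moreover have "(LINT x|lborel. 2 * pi\<^sup>2 * (norm h)\<^sup>2 * ((1 + norm x) ^ 2 * norm (f x))) =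
    2 * pi\<^sup>2 * (norm h)\<^sup>2 * (LINT x|lborel. (1 + norm x) ^ 2 * norm (f x))"
    by (rule integral_mult_right_zero)
  ultimately show "norm (fourier f y - fourier f \<xi> - (\<Sum>i\<in>UNIV. complex_of_real ((y - \<xi>) $ i) * fourier (?g i) \<xi>)) \<le>
    2 * pi\<^sup>2 * (LINT x|lborel. (1 + norm x) ^ 2 * norm (f x)) * (norm (y - \<xi>))\<^sup>2"
    by (simp only: h_def mult_ac)
qed

lemma partial_deriv_fourier:
  assumes f: "f \<in> schwartz"
  shows "partial_deriv i (fourier f) = fourier (\<lambda>x. - 2 * complex_of_real pi * \<i> * complex_of_real (x $ i) * f x)"
proof
  fix \<xi>
  show "partial_deriv i (fourier f) \<xi> = fourier (\<lambda>x. - 2 * complex_of_real pi * \<i> * complex_of_real (x $ i) * f x) \<xi>"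
    unfolding partial_deriv_eq[OF fourier_has_derivative[OF f]]
    by (subst sum.remove[of _ i]) (auto simp: axis_def)
qed

lemma fourier_partial_deriv:
  fixes f :: "real^'n \<Rightarrow> complex"
  assumes f: "f \<in> schwartz"
  shows "fourier (partial_deriv i f) \<xi> = 2 * complex_of_real pi * \<i> * complex_of_real (\<xi> $ i) * fourier f \<xi>"
proof -
  let ?w = "plane_wave (- \<xi>)" and ?c = "2 * complex_of_real pi * \<i> * complex_of_real (\<xi> $ i)"
  have fw: "(\<lambda>x. ?w x * f x) \<in> schwartz" using f by (intro schwartz_slow_mult slow.wave)
  have w: "partial_deriv i ?w x = - ?c * ?w x" for x
    by (simp add: partial_deriv_eq[OF has_derivative_plane_wave] inner_axis' inner_commute[of \<xi>])
  have "partial_deriv i (\<lambda>x. ?w x * f x) x = partial_deriv i f x * ?w x - ?c * (f x * ?w x)" for x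
    by (subst partial_deriv_mult[OF slow_differentiable[OF slow.wave] schwartz_differentiable[OF f]])
       (simp add: w algebra_simps)
  then have "0 = (LINT x|lborel. partial_deriv i f x * ?w x - ?c * (f x * ?w x))"
    using integral_partial_deriv[OF fw, of i] by simp
  also have "\<dots> = fourier (partial_deriv i f) \<xi> - ?c * fourier f \<xi>"
    unfolding fourier_eq
    using integrable_plane_wave[OF schwartz_integrable[OF f], of "- \<xi>"]
      integrable_plane_wave[OF schwartz_integrable[OF schwartz_partial_deriv[OF f]], of i "- \<xi>"]
    by simp
  finally show ?thesis by simp
qed

text \<open>Each factor \<open>1 + norm \<xi> \<le> 1 + (\<Sum>i. |\<xi>\<^sub>i|)\<close> is traded for derivatives of \<open>f\<close>.\<close>

lemma fourier_rapidly_decreasing: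
  fixes f :: "real^'n \<Rightarrow> complex"
  assumes "f \<in> schwartz"
  shows "rapidly_decreasing (fourier f)"
  unfolding rapidly_decreasing_def
proof
  fix k
  show "\<exists>C. \<forall>\<xi>. (1 + norm \<xi>) ^ k * norm (fourier f \<xi>) \<le> C"
    using assms
  proof (induction k arbitrary: f)
    case 0
    have "norm (fourier f \<xi>) \<le> (LINT x|lborel. norm (f x))" for \<xi>
      unfolding fourier_eq
      by (rule order_trans[OF integral_norm_bound]) (simp add: norm_mult)
    then show ?case by auto
  next
    case (Suc k)
    from Suc.IH[OF Suc.prems] obtain C where C: "\<And>\<xi>. (1 + norm \<xi>) ^ k * norm (fourier f \<xi>) \<le> C" by blast
    from Suc.IH[OF schwartz_partial_deriv[OF Suc.prems]] obtain D
      where D: "\<And>i \<xi>. (1 + norm \<xi>) ^ k * norm (fourier (partial_deriv i f) \<xi>) \<le> D i" by metis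
    have "(1 + norm \<xi>) ^ Suc k * norm (fourier f \<xi>) \<le> C + (\<Sum>i\<in>UNIV. D i)" for \<xi>
    proof -
      have c: "\<bar>\<xi> $ i\<bar> * norm (fourier f \<xi>) \<le> norm (fourier (partial_deriv i f) \<xi>)" for i
      proof -
        have "norm (fourier (partial_deriv i f) \<xi>) = (2 * pi) * (\<bar>\<xi> $ i\<bar> * norm (fourier f \<xi>))"
          by (simp add: fourier_partial_deriv[OF Suc.prems] norm_mult)
        moreover have "1 * (\<bar>\<xi> $ i\<bar> * norm (fourier f \<xi>)) \<le> (2 * pi) * (\<bar>\<xi> $ i\<bar> * norm (fourier f \<xi>))"
          using pi_gt3 by (intro mult_right_mono) auto
        ultimately show ?thesis by simp
      qed
      have "(1 + norm \<xi>) * norm (fourier f \<xi>) \<le> (1 + (\<Sum>i\<in>UNIV. \<bar>\<xi> $ i\<bar>)) * norm (fourier f \<xi>)"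
        by (intro mult_right_mono add_left_mono norm_le_l1_cart) auto
      also have "\<dots> = norm (fourier f \<xi>) + (\<Sum>i\<in>UNIV. \<bar>\<xi> $ i\<bar> * norm (fourier f \<xi>))"
        by (simp add: distrib_right sum_distrib_right)
      also have "\<dots> \<le> norm (fourier f \<xi>) + (\<Sum>i\<in>UNIV. norm (fourier (partial_deriv i f) \<xi>))"
        by (intro add_left_mono sum_mono c)
      finally have "(1 + norm \<xi>) ^ k * ((1 + norm \<xi>) * norm (fourier f \<xi>)) \<le>
        (1 + norm \<xi>) ^ k * (norm (fourier f \<xi>) + (\<Sum>i\<in>UNIV. norm (fourier (partial_deriv i f) \<xi>)))"
        by (intro mult_left_mono) auto
      also have "\<dots> = (1 + norm \<xi>) ^ k * norm (fourier f \<xi>) +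
          (\<Sum>i\<in>UNIV. (1 + norm \<xi>) ^ k * norm (fourier (partial_deriv i f) \<xi>))"
        by (simp add: distrib_left sum_distrib_left)
      also have "\<dots> \<le> C + (\<Sum>i\<in>UNIV. D i)"
        by (intro add_mono sum_mono C D)
      finally show ?thesis by (simp add: mult_ac)
    qed
    then show ?case by blast
  qed
qed

text \<open>Derivatives of \<open>fourier f\<close> are Fourier transforms of coordinate multiples of \<open>f\<close>, so the image of
  the Schwartz space satisfies the hypotheses of the coinduction principle.\<close>

lemma schwartz_fourier:
  assumes "f \<in> schwartz"
  shows "fourier f \<in> schwartz"
proof -
  have "additive_hull (fourier ` (schwartz :: (real^'a \<Rightarrow> complex) set)) \<subseteq> schwartz"
  proof (rule schwartz_coinduct)
    fix g :: "real^'a \<Rightarrow> complex" assume "g \<in> fourier ` schwartz"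
    then obtain f where g: "g = fourier f" and f: "f \<in> schwartz" by auto
    show "g differentiable at x" for x
      unfolding g by (rule differentiableI[OF fourier_has_derivative[OF f]])
    show "rapidly_decreasing g" unfolding g by (rule fourier_rapidly_decreasing[OF f])
    fix i
    have "(\<lambda>x. - 2 * complex_of_real pi * \<i> * complex_of_real (x $ i) * f x) \<in> schwartz"
      using f by (intro schwartz_slow_mult slow.mult slow.const slow.coord)
    then show "partial_deriv i g \<in> additive_hull (fourier ` schwartz)"
      unfolding g partial_deriv_fourier[OF f] by (intro additive_hull.base imageI)
  qed
  then show ?thesis using assms by (blast intro: additive_hull.base)
qed

lemma schwartz_inv_fourier:
  assumes "f \<in> schwartz"
  shows "inv_fourier f \<in> schwartz"
  using assms by (simp add: inv_fourier_reflect schwartz_measurable schwartz_fourier schwartz_uminus)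

lemma fourier_linear:
  assumes "f \<in> schwartz" "g \<in> schwartz"
  shows "fourier (\<lambda>x. f x - c * g x) = (\<lambda>\<xi>. fourier f \<xi> - c * fourier g \<xi>)"
proof
  fix \<xi>
  have "integrable lborel (\<lambda>x. f x * plane_wave (- \<xi>) x)" "integrable lborel (\<lambda>x. g x * plane_wave (- \<xi>) x)"
    using assms by (auto intro: integrable_plane_wave schwartz_integrable)
  then have "(LINT x|lborel. f x * plane_wave (- \<xi>) x - c * (g x * plane_wave (- \<xi>) x)) = fourier f \<xi> - c * fourier g \<xi>"
    by (simp add: fourier_eq)
  then show "fourier (\<lambda>x. f x - c * g x) \<xi> = fourier f \<xi> - c * fourier g \<xi>"
    by (simp add: fourier_eq algebra_simps)
qed

section \<open>The Gaussian and Fourier inversion\<close>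

lemma
  fixes \<eta> :: real
  shows integrable_gauss_real: "integrable lborel (\<lambda>t. complex_of_real (exp (- pi * t\<^sup>2)) * exp (\<i> * complex_of_real (2 * pi * t * \<eta>)))"
    and fourier_gauss_real: "(LINT t|lborel. complex_of_real (exp (- pi * t\<^sup>2)) * exp (\<i> * complex_of_real (2 * pi * t * \<eta>))) =
      complex_of_real (exp (- pi * \<eta>\<^sup>2))"
proof -
  \<comment> \<open>The dilation by \<open>c\<close> turns the standard normal density into \<open>exp (- pi * t\<^sup>2)\<close>.\<close>
  define c where "c = sqrt (2 * pi)"
  have c: "c > 0" "c * c = 2 * pi" by (simp_all add: c_def)
  define g where "g x = std_normal_density x *\<^sub>R exp (\<i> * complex_of_real (c * \<eta> * x))" for x
  have g: "c *\<^sub>R g (0 + c * t) = complex_of_real (exp (- pi * t\<^sup>2)) * exp (\<i> * complex_of_real (2 * pi * t * \<eta>))" for t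
  proof -
    have "c * \<eta> * (0 + c * t) = (c * c) * t * \<eta>" by simp
    then have 1: "c * \<eta> * (0 + c * t) = 2 * pi * t * \<eta>" by (simp only: c(2))
    have "(0 + c * t)\<^sup>2 / 2 = pi * t\<^sup>2" by (simp add: c_def power_mult_distrib)
    then have "std_normal_density (0 + c * t) = (1 / c) * exp (- pi * t\<^sup>2)"
      by (simp add: std_normal_density_def c_def[symmetric])
    then have 2: "c * std_normal_density (0 + c * t) = exp (- pi * t\<^sup>2)" using c(1) by simp
    show ?thesis unfolding g_def 1 scaleR_scaleR 2 by (rule scaleR_conv_of_real)
  qed
  have [measurable]: "g \<in> borel_measurable borel" unfolding g_def[abs_def] by measurable
  have int: "integrable lborel g"
  proof (rule Bochner_Integration.integrable_bound)
    show "integrable lborel std_normal_density" by simp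
    show "AE x in lborel. norm (g x) \<le> norm (std_normal_density x)"
      unfolding g_def by (simp del: of_real_mult)
  qed simp
  from lborel_integrable_real_affine[OF int, of c 0] c(1) have "integrable lborel (\<lambda>t. c *\<^sub>R g (0 + c * t))"
    by (intro integrable_scaleR_right) auto
  then show "integrable lborel (\<lambda>t. complex_of_real (exp (- pi * t\<^sup>2)) * exp (\<i> * complex_of_real (2 * pi * t * \<eta>)))"
    unfolding g .
  have "(LINT t|lborel. c *\<^sub>R g (0 + c * t)) = (LINT x|lborel. g x)"
    using lborel_integral_real_affine[of c g 0] c(1) by simp
  also have "\<dots> = char std_normal_distribution (c * \<eta>)"
    unfolding char_def g_def by (subst integral_density) (auto simp: normal_density_nonneg)
  also have "\<dots> = complex_of_real (exp (- pi * \<eta>\<^sup>2))"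
    by (simp add: char_std_normal_distribution c_def power_mult_distrib)
  finally show "(LINT t|lborel. complex_of_real (exp (- pi * t\<^sup>2)) * exp (\<i> * complex_of_real (2 * pi * t * \<eta>))) =
      complex_of_real (exp (- pi * \<eta>\<^sup>2))"
    unfolding g .
qed

lemma gauss_prod: "gauss x = (\<Prod>i\<in>UNIV. complex_of_real (exp (- pi * (x $ i)\<^sup>2)))"
proof -
  have "(norm x)\<^sup>2 = (\<Sum>i\<in>UNIV. (x $ i)\<^sup>2)"
    unfolding power2_norm_eq_inner inner_vec_def by (simp add: power2_eq_square)
  then have "exp (- pi * (norm x)\<^sup>2) = (\<Prod>i\<in>UNIV. exp (- pi * (x $ i)\<^sup>2))"
    by (simp add: sum_distrib_left exp_sum flip: sum_negf)
  then show ?thesis by (simp add: gauss_def)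
qed

lemma plane_wave_prod: "plane_wave y x = (\<Prod>i\<in>UNIV. exp (\<i> * complex_of_real (2 * pi * x $ i * y $ i)))"
  by (simp add: plane_wave_def inner_vec_def exp_sum[symmetric] sum_distrib_left mult_ac)

text \<open>With the factor \<open>2\<pi>\<close> in the exponent this Gaussian is its own transform, which gives at once its
  total mass, the inversion formula and the heat kernels. In one dimension it is the
  characteristic function of the normal distribution, rescaled by \<open>sqrt (2\<pi>)\<close>.\<close>

lemma fourier_gauss: "fourier gauss = gauss"
proof
  fix y :: "real^'a"
  have "gauss x * plane_wave (- y) x =
    (\<Prod>i\<in>UNIV. complex_of_real (exp (- pi * (x $ i)\<^sup>2)) * exp (\<i> * complex_of_real (2 * pi * x $ i * (- y) $ i)))" for x
    unfolding gauss_prod plane_wave_prod prod.distrib ..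
  then have "fourier gauss y = (LINT x|lborel. (\<Prod>i\<in>UNIV. complex_of_real (exp (- pi * (x $ i)\<^sup>2)) *
      exp (\<i> * complex_of_real (2 * pi * x $ i * (- y) $ i))))"
    by (simp only: fourier_eq)
  also have "\<dots> = (\<Prod>i\<in>UNIV. (LINT t|lborel. complex_of_real (exp (- pi * t\<^sup>2)) *
      exp (\<i> * complex_of_real (2 * pi * t * (- y) $ i))))"
    by (rule integral_prod_coordinates[OF integrable_gauss_real])
  also have "\<dots> = gauss y"
    unfolding fourier_gauss_real gauss_prod by simp
  finally show "fourier gauss y = gauss y" .
qed

lemma integral_gauss: "(LINT x|lborel. gauss x) = 1"
  using fun_cong[OF fourier_gauss, of 0] by (simp add: fourier_eq gauss_def)

text \<open>The form in which Fubini's theorem is applied to plane waves.\<close>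

lemma integrable_bounded_kernel:
  fixes f g :: "_ \<Rightarrow> complex"
  assumes "sigma_finite_measure M" "sigma_finite_measure N"
    and f: "integrable M f" and g: "integrable N g"
    and k: "(\<lambda>(x, y). k x y) \<in> borel_measurable (M \<Otimes>\<^sub>M N)" "\<And>x y. norm (k x y) \<le> (1::real)"
  shows "integrable (M \<Otimes>\<^sub>M N) (\<lambda>(x, y). f x * g y * k x y)"
proof -
  interpret M: sigma_finite_measure M by fact
  interpret N: sigma_finite_measure N by fact
  interpret pair_sigma_finite M N ..
  have [measurable]: "f \<in> borel_measurable M" "g \<in> borel_measurable N" using f g by auto
  have prod: "integrable (M \<Otimes>\<^sub>M N) (\<lambda>(x, y). f x * g y)"
  proof (rule Fubini_integrable)
    show "integrable M (\<lambda>x. LINT y|N. norm (case (x, y) of (x, y) \<Rightarrow> f x * g y))"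
      using f g by (simp add: norm_mult)
  qed (use g in auto)
  show ?thesis
  proof (rule Bochner_Integration.integrable_bound[OF prod])
    show "AE z in M \<Otimes>\<^sub>M N. norm (case z of (x, y) \<Rightarrow> f x * g y * k x y) \<le> norm (case z of (x, y) \<Rightarrow> f x * g y)"
      using k(2) by (auto intro!: AE_I2 simp: norm_mult mult_left_le)
    have "(\<lambda>z. (\<lambda>(x, y). f x * g y) z * (\<lambda>(x, y). k x y) z) \<in> borel_measurable (M \<Otimes>\<^sub>M N)"
      using k(1) by (intro borel_measurable_times) auto
    then show "(\<lambda>(x, y). f x * g y * k x y) \<in> borel_measurable (M \<Otimes>\<^sub>M N)"
      by (simp add: case_prod_beta')
  qed
qed

lemma plane_wave_pair_measurable [measurable]:
  "(\<lambda>(x, y). plane_wave (- y) x) \<in> borel_measurable (borel \<Otimes>\<^sub>M borel)"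
  unfolding plane_wave_def[abs_def] borel_prod
  by (intro borel_measurable_continuous_onI) (auto intro!: continuous_intros simp: case_prod_beta')

lemma fourier_multiplication:
  fixes f g :: "real^'n \<Rightarrow> complex"
  assumes "integrable lborel f" "integrable lborel g"
  shows "(LINT y|lborel. fourier f y * g y) = (LINT x|lborel. f x * fourier g x)"
proof -
  have "integrable (lborel \<Otimes>\<^sub>M lborel) (\<lambda>(x, y). f x * g y * plane_wave (- y) x)"
    by (rule integrable_bounded_kernel[OF sigma_finite_lborel sigma_finite_lborel assms]) auto
  from lborel_pair.Fubini_integral[OF this]
  have "(LINT y|lborel. LINT x|lborel. f x * g y * plane_wave (- y) x) =
    (LINT x|lborel. LINT y|lborel. f x * g y * plane_wave (- y) x)" .
  moreover have "(LINT x|lborel. f x * g y * plane_wave (- y) x) = fourier f y * g y" for y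
    using integral_mult_right_zero[of lborel "g y" "\<lambda>x. f x * plane_wave (- y) x"]
    by (simp add: fourier_eq mult_ac)
  moreover have "(LINT y|lborel. f x * g y * plane_wave (- y) x) = f x * fourier g x" for x
  proof -
    have "plane_wave (- y) x = plane_wave (- x) y" for y
      by (simp add: plane_wave_def inner_commute)
    then show ?thesis by (simp add: fourier_eq mult.assoc)
  qed
  ultimately show ?thesis by simp
qed

lemma norm_gauss_le: "norm (gauss x) \<le> 1"
  by (simp add: gauss_def)

lemma gauss_measurable [measurable]: "gauss \<in> borel_measurable borel"
  by (rule schwartz_measurable[OF schwartz_gauss])

text \<open>Apply the multiplication formula to \<open>f\<close> and the damped wave
  \<open>plane_wave x y * gauss (e y)\<close>, whose transform is an approximate identity centred at \<open>x\<close>,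
  and let \<open>e\<close> tend to \<open>0\<close> on both sides.\<close>

theorem fourier_inversion:
  fixes f :: "real^'n \<Rightarrow> complex"
  assumes f: "f \<in> schwartz"
  shows "inv_fourier (fourier f) = f"
proof
  fix x :: "real^'n"
  define e where "e n = 1 / real (Suc n)" for n
  have e: "e n > 0" for n by (simp add: e_def)
  have e0: "e \<longlonglongrightarrow> 0"
    unfolding e_def using LIMSEQ_inverse_real_of_nat by (simp add: inverse_eq_divide)
  have ff: "fourier f \<in> schwartz" by (rule schwartz_fourier[OF f])
  have [measurable]: "f \<in> borel_measurable borel" "fourier f \<in> borel_measurable borel"
    using f ff by (auto intro: schwartz_measurable)
  \<comment> \<open>The multiplication formula for the damped wave, with the factors \<open>e n\<close> scaled into the argument of \<open>f\<close>.\<close>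
  have eq: "(LINT y|lborel. fourier f y * (plane_wave x y * gauss (e n *\<^sub>R y))) = (LINT z|lborel. f (x + e n *\<^sub>R z) * gauss z)" for n
  proof -
    let ?\<phi> = "\<lambda>y. plane_wave x y * gauss (e n *\<^sub>R y)"
    have "integrable lborel (\<lambda>y::real^'n. gauss (e n *\<^sub>R y))"
      using integrable_affine[of "e n" "gauss :: real^'n \<Rightarrow> complex" 0]
        schwartz_integrable[OF schwartz_gauss, where 'a='n] e[of n] by simp
    from integrable_plane_wave[OF this, of x] have int: "integrable lborel ?\<phi>" by (simp add: mult.commute)
    have "fourier ?\<phi> y = complex_of_real ((1 / e n) ^ CARD('n)) * gauss ((1 / e n) *\<^sub>R (y - x))" for y
    proof -
      have "fourier ?\<phi> y = (LINT \<xi>|lborel. gauss (e n *\<^sub>R \<xi>) * plane_wave (x - y) \<xi>)"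
        unfolding fourier_eq using plane_wave_add[of x "- y"] by (simp add: mult_ac)
      also have "\<dots> = (1 / e n) ^ CARD('n) *\<^sub>R (LINT \<xi>|lborel. gauss \<xi> * plane_wave (x - y) ((1 / e n) *\<^sub>R \<xi>))"
        using integral_affine[of "1 / e n" "\<lambda>\<xi>. gauss (e n *\<^sub>R \<xi>) * plane_wave (x - y) \<xi>" 0] e[of n] by simp
      also have "(\<lambda>\<xi>. plane_wave (x - y) ((1 / e n) *\<^sub>R \<xi>)) = plane_wave (- ((1 / e n) *\<^sub>R (y - x)))"
        by (intro ext) (simp add: plane_wave_def inner_diff_right algebra_simps diff_divide_distrib)
      then have "(LINT \<xi>|lborel. gauss \<xi> * plane_wave (x - y) ((1 / e n) *\<^sub>R \<xi>)) = fourier gauss ((1 / e n) *\<^sub>R (y - x))"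
        unfolding fourier_eq by metis
      finally show ?thesis by (simp add: fourier_gauss scaleR_conv_of_real)
    qed
    then have "(LINT y|lborel. fourier f y * ?\<phi> y) =
        (LINT y|lborel. f y * (complex_of_real ((1 / e n) ^ CARD('n)) * gauss ((1 / e n) *\<^sub>R (y - x))))"
      using fourier_multiplication[OF schwartz_integrable[OF f] int] by simp
    also have "\<dots> = \<bar>e n\<bar> ^ CARD('n) *\<^sub>R (LINT z|lborel. f (x + e n *\<^sub>R z) * (complex_of_real ((1 / e n) ^ CARD('n)) * gauss z))"
      using e[of n] by (subst integral_affine[of "e n" _ x]) auto
    also have "\<dots> = (\<bar>e n\<bar> ^ CARD('n) * (1 / e n) ^ CARD('n)) *\<^sub>R (LINT z|lborel. f (x + e n *\<^sub>R z) * gauss z)"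
    proof -
      have "f (x + e n *\<^sub>R z) * (complex_of_real r * gauss z) = complex_of_real r * (f (x + e n *\<^sub>R z) * gauss z)" for z r
        by simp
      then show ?thesis
        by (simp only: integral_mult_right_zero) (simp add: scaleR_conv_of_real)
    qed
    also have "\<bar>e n\<bar> ^ CARD('n) * (1 / e n) ^ CARD('n) = 1"
      using e[of n] by (simp flip: power_mult_distrib)
    finally show ?thesis by simp
  qed
  have cont: "(\<lambda>n. g (t + e n *\<^sub>R z)) \<longlonglongrightarrow> g t" if "g \<in> schwartz" for g :: "real^'n \<Rightarrow> complex" and t z
  proof -
    have "(\<lambda>n. t + e n *\<^sub>R z) \<longlonglongrightarrow> t + 0 *\<^sub>R z" by (intro tendsto_intros e0)
    moreover have "isCont g t"
      using schwartz_continuous[OF that, of UNIV] by (simp add: continuous_on_eq_continuous_at)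
    ultimately show ?thesis by (auto intro: isCont_tendsto_compose)
  qed
  have "(\<lambda>n. LINT y|lborel. fourier f y * (plane_wave x y * gauss (e n *\<^sub>R y))) \<longlonglongrightarrow> (LINT y|lborel. fourier f y * (plane_wave x y * gauss (0 :: real^'n)))"
  proof (rule integral_dominated_convergence[where w="\<lambda>y. norm (fourier f y)"])
    show "integrable lborel (\<lambda>y. norm (fourier f y))"
      by (intro integrable_norm schwartz_integrable ff)
    show "AE y in lborel. (\<lambda>n. fourier f y * (plane_wave x y * gauss (e n *\<^sub>R y))) \<longlonglongrightarrow> fourier f y * (plane_wave x y * gauss (0 :: real^'n))"
    proof (rule AE_I2)
      fix y :: "real^'n"
      have "(\<lambda>n. gauss (e n *\<^sub>R y)) \<longlonglongrightarrow> gauss (0 :: real^'n)"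
        using cont[OF schwartz_gauss, of 0 y] by simp
      then show "(\<lambda>n. fourier f y * (plane_wave x y * gauss (e n *\<^sub>R y))) \<longlonglongrightarrow> fourier f y * (plane_wave x y * gauss (0 :: real^'n))"
        by (intro tendsto_mult tendsto_const)
    qed
    show "AE y in lborel. norm (fourier f y * (plane_wave x y * gauss (e n *\<^sub>R y))) \<le> norm (fourier f y)" for n
      by (intro AE_I2) (simp add: norm_mult norm_gauss_le mult_left_le)
  qed auto
  moreover have "(LINT y|lborel. fourier f y * (plane_wave x y * gauss (0 :: real^'n))) = inv_fourier (fourier f) x"
    by (simp add: gauss_def inv_fourier_eq)
  moreover have "(\<lambda>n. LINT z|lborel. f (x + e n *\<^sub>R z) * gauss z) \<longlonglongrightarrow> (LINT z|lborel. f x * gauss (z :: real^'n))"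
  proof -
    obtain C where C: "C \<ge> 0" "\<And>x. norm (f x) \<le> C" using schwartz_bounded[OF f] by blast
    show ?thesis
    proof (rule integral_dominated_convergence[where w="\<lambda>z. C * norm (gauss z)"])
      show "integrable lborel (\<lambda>z::real^'n. C * norm (gauss z))"
        by (intro integrable_mult_right integrable_norm schwartz_integrable schwartz_gauss)
      show "AE z in lborel. (\<lambda>n. f (x + e n *\<^sub>R z) * gauss z) \<longlonglongrightarrow> f x * gauss (z :: real^'n)"
        by (intro AE_I2 tendsto_intros cont f)
      show "AE z in lborel. norm (f (x + e n *\<^sub>R z) * gauss z) \<le> C * norm (gauss z)" for n
        by (intro AE_I2) (simp add: norm_mult C mult_right_mono)
    qed auto
  qed
  moreover have "(LINT z|lborel. f x * gauss (z :: real^'n)) = f x" by (simp add: integral_gauss)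
  ultimately have "(\<lambda>n. LINT z|lborel. f (x + e n *\<^sub>R z) * gauss z) \<longlonglongrightarrow> inv_fourier (fourier f) x"
    and "(\<lambda>n. LINT z|lborel. f (x + e n *\<^sub>R z) * gauss z) \<longlonglongrightarrow> f x"
    by (simp_all only: eq)
  then show "inv_fourier (fourier f) x = f x" by (rule LIMSEQ_unique)
qed

lemma fourier_inversion':
  fixes f :: "real^'n \<Rightarrow> complex"
  assumes f: "f \<in> schwartz"
  shows "fourier (inv_fourier f) = f"
proof -
  have [measurable]: "fourier f \<in> borel_measurable borel" "inv_fourier f \<in> borel_measurable borel"
    by (intro schwartz_measurable schwartz_fourier schwartz_inv_fourier f)+
  have "fourier (inv_fourier f) = fourier (\<lambda>x. fourier f (- x))"
    by (simp add: inv_fourier_uminus[abs_def])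
  also have "\<dots> = inv_fourier (fourier f)" by (rule inv_fourier_reflect[symmetric]) measurable
  also have "\<dots> = f" by (rule fourier_inversion[OF f])
  finally show ?thesis .
qed

section \<open>Multipliers of Lebesgue spaces\<close>

lemma Lp_measurable: "h \<in> Lp_funs p \<Longrightarrow> h \<in> borel_measurable borel"
  by (auto simp: Lp_funs_def)

lemma one_le_enn2real:
  fixes p :: ennreal
  assumes "1 \<le> p" "p \<noteq> \<infinity>"
  shows "1 \<le> enn2real p"
  using assms by (cases p) simp_all

text \<open>A dominating function in \<open>L\<^sup>1 + L\<^sup>\<infinity>\<close> is all that integrability statements need, and it treats
  finite and infinite exponents alike.\<close>

lemma Lp_decompose:
  assumes "1 \<le> p" "h \<in> Lp_funs p"
  obtains C H where "C \<ge> 0" "integrable lborel H" "\<And>x. 0 \<le> H x" "AE x in lborel. norm (h x) \<le> C + H x"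
proof (cases "p = \<infinity>")
  case True
  with assms obtain C where "AE x in lborel. norm (h x) \<le> C" by (auto simp: Lp_funs_def)
  then have "AE x in lborel. norm (h x) \<le> \<bar>C\<bar> + 0" by eventually_elim linarith
  then show ?thesis using that[of "\<bar>C\<bar>" "\<lambda>x. 0"] by simp
next
  case False
  then have q: "1 \<le> enn2real p" using assms(1) by (simp add: one_le_enn2real)
  have "norm (h x) \<le> 1 + norm (h x) powr enn2real p" for x
  proof (cases "norm (h x) \<le> 1")
    case False
    then have "norm (h x) powr 1 \<le> norm (h x) powr enn2real p" using q by (intro powr_mono) auto
    with False show ?thesis by simp
  qed (simp add: add_increasing2)
  then show ?thesis
    using that[of 1 "\<lambda>x. norm (h x) powr enn2real p"] assms False by (auto simp: Lp_funs_def)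
qed

lemma AE_translate:
  fixes a :: "real^'n"
  assumes "AE x in lborel. P x"
  shows "AE x in lborel. P (a + x)"
proof -
  have "distr lborel borel ((+) a) = (lborel :: (real^'n) measure)" by (rule lborel_distr_plus)
  with assms have "AE x in distr lborel borel ((+) a). P x" by (simp only:)
  then show ?thesis by (rule AE_distrD[rotated]) simp
qed

text \<open>The bound is uniform in the translation. This serves twice: it justifies Fubini's theorem for
  averages of translates, and it shows that coordinate functions are not in \<open>L\<^sup>p\<close>.\<close>

lemma Lp_pairing:
  assumes p: "1 \<le> p" and h: "h \<in> Lp_funs p" and f: "f \<in> schwartz"
  shows "\<exists>K. \<forall>t. integrable lborel (\<lambda>x. h x * f (t + x)) \<and> (LINT x|lborel. norm (h x * f (t + x))) \<le> K"
proof -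
  obtain C H where H: "C \<ge> 0" "integrable lborel H" "\<And>x. 0 \<le> H x" "AE x in lborel. norm (h x) \<le> C + H x"
    using Lp_decompose[OF p h] by blast
  obtain B where B: "B \<ge> 0" "\<And>x. norm (f x) \<le> B" using schwartz_bounded[OF f] by blast
  have [measurable]: "h \<in> borel_measurable borel" "f \<in> borel_measurable borel"
    using Lp_measurable[OF h] schwartz_measurable[OF f] by auto
  define w where "w t x = C * norm (f (t + x)) + B * H x" for t x
  have intf: "integrable lborel (\<lambda>x. norm (f (t + x)))" for t
    using integrable_affine[of 1 f t] schwartz_integrable[OF f] by simp
  have w: "integrable lborel (w t)" for t
    unfolding w_def[abs_def] using intf H by auto
  have le: "AE x in lborel. norm (h x * f (t + x)) \<le> norm (w t x)" for t
    using H(4)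
  proof eventually_elim
    case (elim x)
    have "norm (h x * f (t + x)) \<le> (C + H x) * norm (f (t + x))"
      unfolding norm_mult using elim by (intro mult_right_mono) auto
    also have "\<dots> = C * norm (f (t + x)) + H x * norm (f (t + x))" by (simp add: algebra_simps)
    also have "\<dots> \<le> w t x" unfolding w_def using H B
      by (subst mult.commute[of B]) (intro add_left_mono mult_left_mono)
    finally show ?case by simp
  qed
  have int: "integrable lborel (\<lambda>x. h x * f (t + x))" for t
    by (rule Bochner_Integration.integrable_bound[OF w _ le]) simp
  have "(LINT x|lborel. norm (h x * f (t + x))) \<le> C * (LINT x|lborel. norm (f x)) + B * (LINT x|lborel. H x)" for t
  proof -
    have "(LINT x|lborel. norm (h x * f (t + x))) \<le> (LINT x|lborel. w t x)"
      using le[of t] H(1,3) B(1) by (intro integral_mono_AE integrable_norm int w) (auto simp: w_def)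
    also have "\<dots> = C * (LINT x|lborel. norm (f (t + x))) + B * (LINT x|lborel. H x)"
      unfolding w_def using intf[of t] H(2) by simp
    also have "(LINT x|lborel. norm (f (t + x))) = (LINT x|lborel. norm (f x))"
      by (rule integral_translate) simp
    finally show ?thesis .
  qed
  with int show ?thesis by blast
qed

lemma Lp_pairing_integrable:
  assumes "1 \<le> p" "h \<in> Lp_funs p" "f \<in> schwartz"
  shows "integrable lborel (\<lambda>x. h x * f x)"
proof -
  have "integrable lborel (\<lambda>x. h x * f (0 + x))" using Lp_pairing[OF assms] by blast
  then show ?thesis by simp
qed

lemma Lp_cmult:
  assumes "h \<in> Lp_funs p"
  shows "(\<lambda>x. c * h x) \<in> Lp_funs p"
proof (cases "p = \<infinity>")
  case True
  with assms obtain C where C: "AE x in lborel. norm (h x) \<le> C" by (auto simp: Lp_funs_def)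
  then have "AE x in lborel. norm (c * h x) \<le> norm c * C"
    by eventually_elim (simp add: norm_mult mult_left_mono)
  then show ?thesis using assms True by (auto simp: Lp_funs_def)
next
  case False
  have "h \<in> borel_measurable borel" using assms by (rule Lp_measurable)
  with False assms show ?thesis by (simp add: Lp_funs_def norm_mult powr_mult)
qed

lemma Lp_add:
  assumes p: "1 \<le> p" and g: "g \<in> Lp_funs p" and h: "h \<in> Lp_funs p"
  shows "(\<lambda>x. g x + h x) \<in> Lp_funs p"
proof (cases "p = \<infinity>")
  case True
  with assms obtain C D where "AE x in lborel. norm (g x) \<le> C" "AE x in lborel. norm (h x) \<le> D"
    by (auto simp: Lp_funs_def)
  then have "AE x in lborel. norm (g x + h x) \<le> C + D"
    by eventually_elim (metis add_mono norm_triangle_le)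
  then show ?thesis using assms True by (auto simp: Lp_funs_def)
next
  case False
  define q where "q = enn2real p"
  have q: "0 \<le> q" by (simp add: q_def)
  have [measurable]: "g \<in> borel_measurable borel" "h \<in> borel_measurable borel"
    using g h by (auto intro: Lp_measurable)
  have int: "integrable lborel (\<lambda>x. 2 powr q * (norm (g x) powr q + norm (h x) powr q))"
    using g h False by (auto simp: Lp_funs_def q_def)
  have "integrable lborel (\<lambda>x. norm (g x + h x) powr q)"
  proof (rule Bochner_Integration.integrable_bound[OF int])
    have "norm (g x + h x) powr q \<le> 2 powr q * (norm (g x) powr q + norm (h x) powr q)" for x
    proof -
      let ?m = "max (norm (g x)) (norm (h x))"
      have "norm (g x + h x) powr q \<le> (2 * ?m) powr q"
        using norm_triangle_ineq[of "g x" "h x"] q by (intro powr_mono2) auto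
      also have "\<dots> = 2 powr q * ?m powr q" by (simp add: powr_mult)
      also have "?m powr q \<le> norm (g x) powr q + norm (h x) powr q" by (simp add: max_def)
      finally show ?thesis by simp
    qed
    then show "AE x in lborel. norm (norm (g x + h x) powr q) \<le> norm (2 powr q * (norm (g x) powr q + norm (h x) powr q))"
      by (intro AE_I2) (simp add: abs_mult)
  qed simp
  then show ?thesis using False by (simp add: Lp_funs_def q_def)
qed

text \<open>Convexity of \<open>x powr q\<close> on the open half-line gives the case \<open>t > 0\<close>; the case \<open>t = 0\<close> reduces to
  \<open>(1 - q) * c powr q \<le> 0\<close>.\<close>

lemma powr_above_tangent:
  fixes t c q :: real
  assumes "1 \<le> q" "0 < c" "0 \<le> t"
  shows "c powr q + q * c powr (q - 1) * (t - c) \<le> t powr q"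
proof (cases "t = 0")
  case True
  have "c powr (q - 1) * c = c powr q" using assms by (simp add: powr_diff)
  then have "c powr q + q * c powr (q - 1) * (0 - c) = (1 - q) * c powr q" by (simp add: algebra_simps)
  also have "\<dots> \<le> 0" using assms by (intro mult_nonpos_nonneg) auto
  finally show ?thesis using True by simp
next
  case False
  have "((\<lambda>x. x powr q) has_real_derivative q * c powr (q - 1)) (at c within {0<..})"
    using assms by (auto intro!: derivative_eq_intros)
  then have "q * c powr (q - 1) * (t - c) \<le> t powr q - c powr q"
    using assms False by (intro convex_on_imp_above_tangent[OF powr_convex]) (auto simp: interior_open)
  then show ?thesis by simp
qed

text \<open>Jensen's inequality for \<open>x powr q\<close> on \<open>[0, \<infinity>)\<close>, obtained by integrating the tangent at the
  mean value. The endpoint \<open>0\<close> is included, which is why the tangent inequality was stated for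
  \<open>t \<ge> 0\<close>.\<close>

lemma (in finite_measure) power_mean:
  fixes X :: "'a \<Rightarrow> real"
  assumes q: "1 \<le> q" and X: "integrable M X" "\<And>x. 0 \<le> X x" and Xq: "integrable M (\<lambda>x. X x powr q)"
  shows "(LINT x|M. X x) powr q \<le> measure M (space M) powr (q - 1) * (LINT x|M. X x powr q)"
proof (cases "(LINT x|M. X x) = 0")
  case True
  then show ?thesis using X q by (simp add: integral_nonneg)
next
  case False
  define m where "m = measure M (space M)"
  define I where "I = (LINT x|M. X x)"
  have I: "I > 0" using False X by (simp add: I_def integral_nonneg less_le)
  have "m \<noteq> 0"
  proof
    assume "m = 0"
    then have "emeasure M (space M) = 0" by (simp add: m_def emeasure_eq_measure)
    then have "AE x in M. X x = 0" by (intro AE_I'[of "space M"]) auto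
    then have "I = 0" unfolding I_def by (rule integral_eq_zero_AE)
    with I show False by simp
  qed
  then have m: "m > 0" by (simp add: m_def less_le)
  \<comment> \<open>The tangent is taken at the mean value, so that its linear part integrates to \<open>0\<close>.\<close>
  define c where "c = I / m"
  have c: "c > 0" using I m by (simp add: c_def)
  have "(LINT x|M. c powr q + q * c powr (q - 1) * (X x - c)) \<le> (LINT x|M. X x powr q)"
    using X Xq powr_above_tangent[OF q c] by (intro integral_mono) auto
  also have "(LINT x|M. c powr q + q * c powr (q - 1) * (X x - c)) = m * c powr q + q * c powr (q - 1) * (I - m * c)"
    using X by (simp add: m_def I_def)
  also have "m * c = I" using m by (simp add: c_def)
  finally have "m * c powr q \<le> (LINT x|M. X x powr q)" by simp
  then have "m powr (q - 1) * (m * c powr q) \<le> m powr (q - 1) * (LINT x|M. X x powr q)"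
    by (rule mult_left_mono) simp
  moreover have "m powr (q - 1) * (m * c powr q) = I powr q"
    using m I by (simp add: c_def powr_diff powr_divide)
  ultimately show ?thesis by (simp add: m_def I_def)
qed

text \<open>Minkowski's inequality for the convolution with a finite measure: pointwise Jensen, then Tonelli
  and translation invariance. Where \<open>h (z - y)\<close> is not integrable in \<open>y\<close> the integral has the
  default value \<open>0\<close>, which respects the bound.\<close>

lemma Lp_average:
  fixes h :: "real^'n \<Rightarrow> complex" and \<mu> :: "(real^'n) measure"
  assumes p: "1 \<le> p" and h: "h \<in> Lp_funs p" and \<mu>: "finite_measure \<mu>" "sets \<mu> = sets borel"
  shows "(\<lambda>z. LINT y|\<mu>. h (z - y)) \<in> Lp_funs p"
proof -
  interpret \<mu>: finite_measure \<mu> by fact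
  interpret P: pair_sigma_finite \<mu> "lborel :: (real^'n) measure" ..
  interpret Q: pair_sigma_finite "lborel :: (real^'n) measure" \<mu> ..
  define m where "m = measure \<mu> (space \<mu>)"
  note \<mu>(2)[measurable_cong]
  have [measurable]: "h \<in> borel_measurable borel" by (rule Lp_measurable[OF h])
  have meas: "(\<lambda>z. LINT y|\<mu>. h (z - y)) \<in> borel_measurable borel" by measurable
  show ?thesis
  proof (cases "p = \<infinity>")
    case True
    with h obtain C where C: "AE x in lborel. norm (h x) \<le> C" by (auto simp: Lp_funs_def)
    have "AE y in \<mu>. AE z in lborel. norm (h (z - y)) \<le> \<bar>C\<bar>"
    proof (rule AE_I2)
      fix y
      have "AE z in lborel. norm (h (- y + z)) \<le> C" using C by (rule AE_translate)
      then show "AE z in lborel. norm (h (z - y)) \<le> \<bar>C\<bar>" by eventually_elim simp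
    qed
    then have "AE z in lborel. AE y in \<mu>. norm (h (z - y)) \<le> \<bar>C\<bar>"
      by (subst (asm) P.AE_commute) measurable
    then have "AE z in lborel. norm (LINT y|\<mu>. h (z - y)) \<le> \<bar>C\<bar> * m"
    proof eventually_elim
      case (elim z)
      show ?case
      proof (cases "integrable \<mu> (\<lambda>y. h (z - y))")
        case True
        have "norm (LINT y|\<mu>. h (z - y)) \<le> (LINT y|\<mu>. norm (h (z - y)))" by (rule integral_norm_bound)
        also have "\<dots> \<le> (LINT y|\<mu>. \<bar>C\<bar>)" using True elim by (intro integral_mono_AE) auto
        finally show ?thesis by (simp add: m_def mult.commute)
      qed (simp add: not_integrable_integral_eq m_def)
    qed
    with meas True show ?thesis by (auto simp: Lp_funs_def)
  next
    case False
    define q where "q = enn2real p"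
    have q: "1 \<le> q" using p False unfolding q_def by (simp add: one_le_enn2real)
    have hq: "integrable lborel (\<lambda>x. norm (h x) powr q)" using h False by (simp add: Lp_funs_def q_def)
    have tr: "integrable lborel (\<lambda>z. norm (h (z - y)) powr q)"
      "(LINT z|lborel. norm (h (z - y)) powr q) = (LINT x|lborel. norm (h x) powr q)" for y
      using hq integrable_affine[of 1 "\<lambda>x. norm (h x) powr q" "- y"]
        integral_translate[of "\<lambda>x. norm (h x) powr q" "- y"] by simp_all
    have "integrable (\<mu> \<Otimes>\<^sub>M lborel) (\<lambda>(y, z). norm (h (z - y)) powr q)"
    proof (rule P.Fubini_integrable)
      show "(\<lambda>(y, z). norm (h (z - y)) powr q) \<in> borel_measurable (\<mu> \<Otimes>\<^sub>M lborel)" by measurable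
    qed (use tr in auto)
    then have int: "integrable lborel (\<lambda>z. LINT y|\<mu>. norm (h (z - y)) powr q)"
      and AE: "AE z in lborel. integrable \<mu> (\<lambda>y. norm (h (z - y)) powr q)"
      by (rule P.integrable_snd, rule P.AE_integrable_snd)
    have "integrable lborel (\<lambda>z. norm (LINT y|\<mu>. h (z - y)) powr q)"
    proof (rule Bochner_Integration.integrable_bound)
      show "integrable lborel (\<lambda>z. m powr (q - 1) * (LINT y|\<mu>. norm (h (z - y)) powr q))"
        by (rule integrable_mult_right[OF int])
      show "(\<lambda>z. norm (LINT y|\<mu>. h (z - y)) powr q) \<in> borel_measurable lborel" using meas by simp
      show "AE z in lborel. norm (norm (LINT y|\<mu>. h (z - y)) powr q) \<le>
        norm (m powr (q - 1) * (LINT y|\<mu>. norm (h (z - y)) powr q))"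
        using AE
      proof eventually_elim
        case (elim z)
        show ?case
        proof (cases "integrable \<mu> (\<lambda>y. h (z - y))")
          case True
          have "norm (LINT y|\<mu>. h (z - y)) powr q \<le> (LINT y|\<mu>. norm (h (z - y))) powr q"
            using q by (intro powr_mono2 integral_norm_bound) auto
          also have "\<dots> \<le> m powr (q - 1) * (LINT y|\<mu>. norm (h (z - y)) powr q)"
            unfolding m_def using True elim by (intro \<mu>.power_mean q) auto
          finally show ?thesis by simp
        qed (simp add: not_integrable_integral_eq)
      qed
    qed
    with meas False show ?thesis by (simp add: Lp_funs_def q_def)
  qed
qed

text \<open>The operator with symbol \<open>a\<close> maps \<open>h\<close> to \<open>h'\<close> in the sense of distributions. Existence of \<open>h'\<close> in
  \<open>L\<^sup>p\<close> is all that the inclusion of spaces requires; without a norm estimate in the definition,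
  products and differences of multipliers are immediate.\<close>

definition Lp_multiplier :: "ennreal \<Rightarrow> (real^'n \<Rightarrow> complex) \<Rightarrow> bool"
  where "Lp_multiplier p a \<longleftrightarrow> a \<in> slow \<and> (\<forall>h\<in>Lp_funs p. \<exists>h'\<in>Lp_funs p. \<forall>f\<in>schwartz.
    (LINT x|lborel. h' x * f x) = (LINT x|lborel. h x * fourier (\<lambda>\<xi>. a \<xi> * inv_fourier f \<xi>) x))"

lemma schwartz_multiplier:
  assumes "a \<in> slow" "f \<in> schwartz"
  shows "fourier (\<lambda>\<xi>. a \<xi> * inv_fourier f \<xi>) \<in> schwartz"
  by (intro schwartz_fourier schwartz_slow_mult schwartz_inv_fourier assms)

lemma Lp_multiplier_mult:
  fixes a b :: "real^'n \<Rightarrow> complex"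
  assumes a: "Lp_multiplier p a" and b: "Lp_multiplier p b"
  shows "Lp_multiplier p (\<lambda>\<xi>. a \<xi> * b \<xi>)"
  unfolding Lp_multiplier_def
proof (intro conjI ballI)
  have slow: "a \<in> slow" "b \<in> slow" using a b by (auto simp: Lp_multiplier_def)
  then show "(\<lambda>\<xi>. a \<xi> * b \<xi>) \<in> slow" by (rule slow.mult)
  fix h :: "real^'n \<Rightarrow> complex" assume "h \<in> Lp_funs p"
  with a obtain h1 where h1: "h1 \<in> Lp_funs p" "\<And>f. f \<in> schwartz \<Longrightarrow>
    (LINT x|lborel. h1 x * f x) = (LINT x|lborel. h x * fourier (\<lambda>\<xi>. a \<xi> * inv_fourier f \<xi>) x)"
    unfolding Lp_multiplier_def by blast
  with b obtain h2 where h2: "h2 \<in> Lp_funs p" "\<And>f. f \<in> schwartz \<Longrightarrow>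
    (LINT x|lborel. h2 x * f x) = (LINT x|lborel. h1 x * fourier (\<lambda>\<xi>. b \<xi> * inv_fourier f \<xi>) x)"
    unfolding Lp_multiplier_def by blast
  have eq: "(LINT x|lborel. h2 x * f x) = (LINT x|lborel. h x * fourier (\<lambda>\<xi>. a \<xi> * b \<xi> * inv_fourier f \<xi>) x)"
    if f: "f \<in> schwartz" for f
  proof -
    have "inv_fourier (fourier (\<lambda>\<xi>. b \<xi> * inv_fourier f \<xi>)) = (\<lambda>\<xi>. b \<xi> * inv_fourier f \<xi>)"
      by (intro fourier_inversion schwartz_slow_mult schwartz_inv_fourier slow f)
    then show ?thesis
      by (simp add: h2(2)[OF f] h1(2)[OF schwartz_multiplier[OF slow(2) f]] mult.assoc)
  qed
  show "\<exists>h'\<in>Lp_funs p. \<forall>f\<in>schwartz. (LINT x|lborel. h' x * f x) =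
    (LINT x|lborel. h x * fourier (\<lambda>\<xi>. a \<xi> * b \<xi> * inv_fourier f \<xi>) x)"
    by (intro bexI[OF _ h2(1)] ballI eq)
qed

lemma Lp_multiplier_one_minus:
  fixes a :: "real^'n \<Rightarrow> complex"
  assumes p: "1 \<le> p" and a: "Lp_multiplier p a"
  shows "Lp_multiplier p (\<lambda>\<xi>. 1 - c * a \<xi>)"
  unfolding Lp_multiplier_def
proof (intro conjI ballI)
  have slow: "a \<in> slow" using a by (auto simp: Lp_multiplier_def)
  have "(\<lambda>\<xi>. 1 + (- c) * a \<xi>) \<in> slow" by (intro slow.add slow.mult slow.const slow)
  then show "(\<lambda>\<xi>. 1 - c * a \<xi>) \<in> slow" by simp
  fix h :: "real^'n \<Rightarrow> complex" assume h: "h \<in> Lp_funs p"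
  with a obtain h1 where h1: "h1 \<in> Lp_funs p" "\<And>f. f \<in> schwartz \<Longrightarrow>
    (LINT x|lborel. h1 x * f x) = (LINT x|lborel. h x * fourier (\<lambda>\<xi>. a \<xi> * inv_fourier f \<xi>) x)"
    unfolding Lp_multiplier_def by blast
  have mem: "(\<lambda>x. h x + (- c) * h1 x) \<in> Lp_funs p" by (intro Lp_add Lp_cmult p h h1)
  have eq: "(LINT x|lborel. (h x + (- c) * h1 x) * f x) =
    (LINT x|lborel. h x * fourier (\<lambda>\<xi>. (1 - c * a \<xi>) * inv_fourier f \<xi>) x)" if f: "f \<in> schwartz" for f
  proof -
    have sc: "inv_fourier f \<in> schwartz" "(\<lambda>\<xi>. a \<xi> * inv_fourier f \<xi>) \<in> schwartz"
      by (intro schwartz_slow_mult schwartz_inv_fourier slow f)+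
    note int = Lp_pairing_integrable[OF p h f] Lp_pairing_integrable[OF p h1(1) f]
      Lp_pairing_integrable[OF p h schwartz_multiplier[OF slow f]]
    have "fourier (\<lambda>\<xi>. (1 - c * a \<xi>) * inv_fourier f \<xi>) = (\<lambda>x. f x - c * fourier (\<lambda>\<xi>. a \<xi> * inv_fourier f \<xi>) x)"
      using fourier_linear[OF sc, of c] by (simp add: fourier_inversion'[OF f] algebra_simps)
    then have "(LINT x|lborel. h x * fourier (\<lambda>\<xi>. (1 - c * a \<xi>) * inv_fourier f \<xi>) x) =
      (LINT x|lborel. h x * f x - c * (h x * fourier (\<lambda>\<xi>. a \<xi> * inv_fourier f \<xi>) x))"
      by (simp add: algebra_simps)
    also have "\<dots> = (LINT x|lborel. h x * f x) - c * (LINT x|lborel. h1 x * f x)"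
      using int by (simp add: h1(2)[OF f])
    also have "\<dots> = (LINT x|lborel. h x * f x - c * (h1 x * f x))"
      using int by simp
    also have "\<dots> = (LINT x|lborel. (h x + (- c) * h1 x) * f x)"
      by (simp add: algebra_simps)
    finally show ?thesis by simp
  qed
  show "\<exists>h'\<in>Lp_funs p. \<forall>f\<in>schwartz. (LINT x|lborel. h' x * f x) =
    (LINT x|lborel. h x * fourier (\<lambda>\<xi>. (1 - c * a \<xi>) * inv_fourier f \<xi>) x)"
    by (intro bexI[OF _ mem] ballI eq)
qed

lemma Lp_multiplier_1: "Lp_multiplier p (\<lambda>\<xi>. 1)"
  unfolding Lp_multiplier_def using slow.const[of 1] by (auto simp: fourier_inversion')

lemma Lp_multiplier_power: "Lp_multiplier p a \<Longrightarrow> Lp_multiplier p (\<lambda>\<xi>. a \<xi> ^ N)"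
  by (induction N) (simp_all add: Lp_multiplier_1 Lp_multiplier_mult)

text \<open>On test functions the multiplier acts by \<open>f \<mapsto> \<integral> f (y + x) d\<mu>(y)\<close>, by Fourier inversion under
  the integral. Moving the translations to the other factor gives the convolution of \<open>h\<close> with \<open>\<mu>\<close>.\<close>

lemma Lp_multiplier_characteristic_function:
  fixes \<mu> :: "(real^'n) measure"
  assumes p: "1 \<le> p" and \<mu>: "finite_measure \<mu>" "sets \<mu> = sets borel"
    and a: "\<And>\<xi>. a \<xi> = (LINT y|\<mu>. plane_wave (- y) \<xi>)" and slow: "a \<in> slow"
  shows "Lp_multiplier p a"
  unfolding Lp_multiplier_def
proof (intro conjI ballI)
  show "a \<in> slow" by fact
  interpret \<mu>: finite_measure \<mu> by fact
  interpret P: pair_sigma_finite \<mu> "lborel :: (real^'n) measure" ..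
  interpret Q: pair_sigma_finite "lborel :: (real^'n) measure" \<mu> ..
  note \<mu>(2)[measurable_cong]
  fix h :: "real^'n \<Rightarrow> complex" assume h: "h \<in> Lp_funs p"
  have [measurable]: "h \<in> borel_measurable borel" by (rule Lp_measurable[OF h])
  have eq: "(LINT z|lborel. (LINT y|\<mu>. h (z - y)) * f z) = (LINT x|lborel. h x * fourier (\<lambda>\<xi>. a \<xi> * inv_fourier f \<xi>) x)"
    if f: "f \<in> schwartz" for f
  proof -
    have [measurable]: "f \<in> borel_measurable borel" by (rule schwartz_measurable[OF f])
    have g: "inv_fourier f \<in> schwartz" by (rule schwartz_inv_fourier[OF f])
    have [measurable]: "inv_fourier f \<in> borel_measurable borel" by (rule schwartz_measurable[OF g])
    have shift: "fourier (\<lambda>\<xi>. a \<xi> * inv_fourier f \<xi>) x = (LINT y|\<mu>. f (y + x))" for x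
    proof -
      have "integrable (lborel \<Otimes>\<^sub>M \<mu>) (\<lambda>(\<xi>, y). inv_fourier f \<xi> * 1 * plane_wave (- y - x) \<xi>)"
      proof (rule integrable_bounded_kernel)
        have [measurable]: "(\<lambda>(\<xi>, y). plane_wave (- y - x) \<xi>) \<in> borel_measurable (borel \<Otimes>\<^sub>M borel)"
          unfolding plane_wave_def[abs_def] borel_prod
          by (intro borel_measurable_continuous_onI) (auto intro!: continuous_intros simp: case_prod_beta')
        show "(\<lambda>(\<xi>, y). plane_wave (- y - x) \<xi>) \<in> borel_measurable (lborel \<Otimes>\<^sub>M \<mu>)" by measurable
      qed (use schwartz_integrable[OF g] in \<open>auto intro: sigma_finite_lborel \<mu>.sigma_finite_measure_axioms\<close>)
      from Q.Fubini_integral[OF this]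
      have 1: "(LINT y|\<mu>. LINT \<xi>|lborel. inv_fourier f \<xi> * plane_wave (- y - x) \<xi>) =
        (LINT \<xi>|lborel. LINT y|\<mu>. inv_fourier f \<xi> * plane_wave (- y - x) \<xi>)" by simp
      have 2: "(LINT y|\<mu>. inv_fourier f \<xi> * plane_wave (- y - x) \<xi>) = a \<xi> * inv_fourier f \<xi> * plane_wave (- x) \<xi>" for \<xi>
      proof -
        have "plane_wave (- y - x) \<xi> = plane_wave (- x) \<xi> * plane_wave (- y) \<xi>" for y
          using plane_wave_add[of "- y" "- x" \<xi>] by simp
        then show ?thesis by (simp add: a)
      qed
      have 3: "(LINT \<xi>|lborel. inv_fourier f \<xi> * plane_wave (- y - x) \<xi>) = f (y + x)" for y
        using fun_cong[OF fourier_inversion'[OF f], of "y + x"] by (simp add: fourier_eq)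
      show ?thesis using 1 unfolding fourier_eq 2 3 by (rule sym)
    qed
    obtain K where K: "\<And>t. integrable lborel (\<lambda>x. h x * f (t + x))" "\<And>t. (LINT x|lborel. norm (h x * f (t + x))) \<le> K"
      using Lp_pairing[OF p h f] by blast
    have Kbound: "integrable \<mu> (\<lambda>y. LINT x|lborel. norm (h x * f (y + x)))"
      using K(2) by (intro \<mu>.integrable_const_bound[where B=K]) (auto simp: integral_nonneg)
    have int1: "integrable (\<mu> \<Otimes>\<^sub>M lborel) (\<lambda>(y, x). h x * f (y + x))"
      using Kbound K(1) by (intro P.Fubini_integrable) auto
    have tr: "(LINT z|lborel. norm (h (z - y) * f z)) = (LINT x|lborel. norm (h x * f (y + x)))"
      "(LINT z|lborel. h (z - y) * f z) = (LINT x|lborel. h x * f (y + x))"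
      "integrable lborel (\<lambda>z. h (z - y) * f z)" for y
      using integral_translate[of "\<lambda>z. norm (h (z - y) * f z)" y] integral_translate[of "\<lambda>z. h (z - y) * f z" y]
        integrable_affine[of 1 "\<lambda>z. h (z - y) * f z" y] K(1)[of y] by simp_all
    have int2: "integrable (\<mu> \<Otimes>\<^sub>M lborel) (\<lambda>(y, z). h (z - y) * f z)"
      using Kbound tr by (intro P.Fubini_integrable) auto
    have "(LINT z|lborel. (LINT y|\<mu>. h (z - y)) * f z) = (LINT z|lborel. LINT y|\<mu>. h (z - y) * f z)"
      by simp
    also have "\<dots> = (LINT y|\<mu>. LINT z|lborel. h (z - y) * f z)"
      by (rule P.Fubini_integral[OF int2])
    also have "\<dots> = (LINT y|\<mu>. LINT x|lborel. h x * f (y + x))" by (simp add: tr)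
    also have "\<dots> = (LINT x|lborel. LINT y|\<mu>. h x * f (y + x))"
      by (rule P.Fubini_integral[OF int1, symmetric])
    also have "\<dots> = (LINT x|lborel. h x * fourier (\<lambda>\<xi>. a \<xi> * inv_fourier f \<xi>) x)"
      unfolding shift by simp
    finally show ?thesis .
  qed
  show "\<exists>h'\<in>Lp_funs p. \<forall>f\<in>schwartz. (LINT x|lborel. h' x * f x) =
      (LINT x|lborel. h x * fourier (\<lambda>\<xi>. a \<xi> * inv_fourier f \<xi>) x)"
    by (intro bexI[OF _ Lp_average[OF p h \<mu>]] ballI eq)
qed

section \<open>Mixtures of powers of the resolvent\<close>

text \<open>If \<open>z\<close> has the density \<open>gauss\<close>, then \<open>sqrt (4\<pi>\<tau>) z\<close> has the characteristic function
  \<open>exp (- 4\<pi>\<^sup>2|\<xi>|\<^sup>2\<tau>)\<close>. Choosing \<open>\<tau>\<close> at random according to \<open>\<nu>\<close>, independently of \<open>z\<close>, realises the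
  mixture as the transform of the law of \<open>sqrt (4\<pi>\<tau>) z\<close>. The hypothesis at \<open>\<xi> = 0\<close> says that \<open>\<nu>\<close>
  is finite.\<close>

lemma Lp_multiplier_gaussian_mixture:
  fixes A :: "real^'n \<Rightarrow> real" and \<nu> :: "'x measure"
  assumes p: "1 \<le> p" and \<tau>[measurable]: "\<tau> \<in> borel_measurable \<nu>" and pos: "AE \<omega> in \<nu>. 0 \<le> \<tau> \<omega>"
    and A: "\<And>\<xi>. (\<integral>\<^sup>+\<omega>. ennreal (exp (- (4 * pi\<^sup>2 * (norm \<xi>)\<^sup>2 * \<tau> \<omega>))) \<partial>\<nu>) = ennreal (A \<xi>)" "\<And>\<xi>. 0 \<le> A \<xi>"
    and slow: "(\<lambda>\<xi>. complex_of_real (A \<xi>)) \<in> slow"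
  shows "Lp_multiplier p (\<lambda>\<xi>. complex_of_real (A \<xi>))"
proof -
  define \<gamma> :: "(real^'n) measure" where "\<gamma> = density lborel (\<lambda>z. ennreal (exp (- pi * (norm z)\<^sup>2)))"
  have sets_\<gamma> [measurable_cong]: "sets \<gamma> = sets borel" by (simp add: \<gamma>_def)
  have int_gauss: "integrable lborel (\<lambda>z::real^'n. exp (- pi * (norm z)\<^sup>2))"
    using integrable_norm[OF schwartz_integrable[OF schwartz_gauss, where 'a='n]] by (simp add: gauss_def)
  have \<gamma>_integral: "(LINT z|\<gamma>. plane_wave (- (c *\<^sub>R z)) \<xi>) = gauss (c *\<^sub>R \<xi>)" for c \<xi>
  proof -
    have swap: "plane_wave (- (c *\<^sub>R z)) \<xi> = plane_wave (- (c *\<^sub>R \<xi>)) z" for z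
      by (simp add: plane_wave_def inner_commute)
    have "(LINT z|\<gamma>. plane_wave (- (c *\<^sub>R z)) \<xi>) = (LINT z|lborel. exp (- pi * (norm z)\<^sup>2) *\<^sub>R plane_wave (- (c *\<^sub>R z)) \<xi>)"
      unfolding \<gamma>_def plane_wave_def by (subst integral_density) auto
    also have "\<dots> = fourier gauss (c *\<^sub>R \<xi>)"
      unfolding swap by (simp add: fourier_eq gauss_def scaleR_conv_of_real[where 'a=complex])
    finally show ?thesis by (simp add: fourier_gauss)
  qed
  have fin_\<gamma>: "finite_measure \<gamma>"
  proof
    have "emeasure \<gamma> (space \<gamma>) = (\<integral>\<^sup>+z. ennreal (exp (- pi * (norm (z :: real^'n))\<^sup>2)) \<partial>lborel)"
      by (simp add: \<gamma>_def emeasure_density)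
    also have "\<dots> < \<infinity>" using int_gauss by (simp add: nn_integral_eq_integral)
    finally show "emeasure \<gamma> (space \<gamma>) \<noteq> \<infinity>" by simp
  qed
  have fin_\<nu>: "finite_measure \<nu>"
  proof
    have "emeasure \<nu> (space \<nu>) = ennreal (A 0)" using A(1)[of 0] by simp
    then show "emeasure \<nu> (space \<nu>) \<noteq> \<infinity>" by simp
  qed
  interpret \<gamma>: finite_measure \<gamma> by fact
  interpret \<nu>: finite_measure \<nu> by fact
  interpret pair_sigma_finite \<nu> \<gamma> ..
  let ?T = "\<lambda>(\<omega>, z). sqrt (4 * pi * \<tau> \<omega>) *\<^sub>R z"
  have [measurable]: "?T \<in> \<nu> \<Otimes>\<^sub>M \<gamma> \<rightarrow>\<^sub>M (borel :: (real^'n) measure)" by measurable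
  interpret \<nu>\<gamma>: finite_measure "\<nu> \<Otimes>\<^sub>M \<gamma>"
    by (rule finite_measure_pair_measure[OF fin_\<gamma> fin_\<nu>])
  define \<mu> where "\<mu> = distr (\<nu> \<Otimes>\<^sub>M \<gamma>) borel ?T"
  have "finite_measure \<mu>" unfolding \<mu>_def by (rule \<nu>\<gamma>.finite_measure_distr) measurable
  moreover have "sets \<mu> = sets borel" by (simp add: \<mu>_def)
  moreover have "complex_of_real (A \<xi>) = (LINT y|\<mu>. plane_wave (- y) \<xi>)" for \<xi>
  proof -
    have [measurable]: "(\<lambda>y::real^'n. plane_wave (- y) \<xi>) \<in> borel_measurable borel"
      unfolding plane_wave_def by measurable
    have int: "integrable (\<nu> \<Otimes>\<^sub>M \<gamma>) (\<lambda>(\<omega>, z). plane_wave (- (sqrt (4 * pi * \<tau> \<omega>) *\<^sub>R z)) \<xi>)"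
    proof (rule \<nu>\<gamma>.integrable_const_bound[where B=1])
      have "(\<lambda>x. plane_wave (- ?T x) \<xi>) \<in> borel_measurable (\<nu> \<Otimes>\<^sub>M \<gamma>)" by measurable
      then show "(\<lambda>(\<omega>, z). plane_wave (- (sqrt (4 * pi * \<tau> \<omega>) *\<^sub>R z)) \<xi>) \<in> borel_measurable (\<nu> \<Otimes>\<^sub>M \<gamma>)"
        by (simp add: case_prod_beta')
    qed auto
    have "(LINT y|\<mu>. plane_wave (- y) \<xi>) = (LINT x|(\<nu> \<Otimes>\<^sub>M \<gamma>). plane_wave (- ?T x) \<xi>)"
      unfolding \<mu>_def by (rule integral_distr) measurable
    also have "\<dots> = (LINT \<omega>|\<nu>. LINT z|\<gamma>. plane_wave (- (sqrt (4 * pi * \<tau> \<omega>) *\<^sub>R z)) \<xi>)"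
      using integral_fst[OF int] by (simp add: case_prod_beta')
    also have "\<dots> = (LINT \<omega>|\<nu>. complex_of_real (exp (- (4 * pi\<^sup>2 * (norm \<xi>)\<^sup>2 * \<tau> \<omega>))))"
    proof (rule integral_cong_AE)
      show "AE \<omega> in \<nu>. (LINT z|\<gamma>. plane_wave (- (sqrt (4 * pi * \<tau> \<omega>) *\<^sub>R z)) \<xi>) =
          complex_of_real (exp (- (4 * pi\<^sup>2 * (norm \<xi>)\<^sup>2 * \<tau> \<omega>)))"
        using pos
      proof eventually_elim
        case (elim \<omega>)
        then show ?case unfolding \<gamma>_integral
          by (simp add: gauss_def power_mult_distrib power2_eq_square mult_ac)
      qed
      show "(\<lambda>\<omega>. LINT z|\<gamma>. plane_wave (- (sqrt (4 * pi * \<tau> \<omega>) *\<^sub>R z)) \<xi>) \<in> borel_measurable \<nu>"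
        using borel_measurable_integrable[OF integrable_fst[OF int]] .
    qed measurable
    also have "\<dots> = complex_of_real (LINT \<omega>|\<nu>. exp (- (4 * pi\<^sup>2 * (norm \<xi>)\<^sup>2 * \<tau> \<omega>)))"
      by (rule integral_complex_of_real)
    also have "(LINT \<omega>|\<nu>. exp (- (4 * pi\<^sup>2 * (norm \<xi>)\<^sup>2 * \<tau> \<omega>))) = A \<xi>"
      by (subst integral_eq_nn_integral) (simp_all add: A)
    finally show ?thesis by simp
  qed
  ultimately show ?thesis
    using slow by (intro Lp_multiplier_characteristic_function[OF p])
qed

lemma gamma_integral_scaled:
  assumes t: "0 < t" and c: "0 < c"
  shows "(\<integral>\<^sup>+\<tau>. ennreal (indicator {0..} \<tau> * \<tau> powr (t - 1) * exp (- (c * \<tau>)) * rGamma t) \<partial>lborel) = ennreal (c powr (- t))"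
proof -
  have G: "Gamma t > 0" using t by (rule Gamma_real_pos)
  let ?I = "\<integral>\<^sup>+\<tau>. ennreal (indicator {0..} \<tau> * \<tau> powr (t - 1) * exp (- (c * \<tau>))) \<partial>lborel"
  have "ennreal (Gamma t) = (\<integral>\<^sup>+s. ennreal (indicator {0..} s * s powr (t - 1) / exp s) \<partial>lborel)"
    by (rule Gamma_conv_nn_integral_real[OF t])
  also have "\<dots> = ennreal \<bar>c\<bar> * (\<integral>\<^sup>+\<tau>. ennreal (indicator {0..} (0 + c * \<tau>) * (0 + c * \<tau>) powr (t - 1) / exp (0 + c * \<tau>)) \<partial>lborel)"
    using c by (intro nn_integral_real_affine) auto
  also have "(\<integral>\<^sup>+\<tau>. ennreal (indicator {0..} (0 + c * \<tau>) * (0 + c * \<tau>) powr (t - 1) / exp (0 + c * \<tau>)) \<partial>lborel) =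
      (\<integral>\<^sup>+\<tau>. ennreal (c powr (t - 1)) * ennreal (indicator {0..} \<tau> * \<tau> powr (t - 1) * exp (- (c * \<tau>))) \<partial>lborel)"
    using c by (intro nn_integral_cong)
      (auto simp: indicator_def powr_mult exp_minus divide_inverse zero_le_mult_iff mult_ac simp flip: ennreal_mult')
  also have "\<dots> = ennreal (c powr (t - 1)) * ?I" by (rule nn_integral_cmult) simp
  also have "ennreal \<bar>c\<bar> * (ennreal (c powr (t - 1)) * ?I) = ennreal (c powr t) * ?I"
    using c by (simp add: powr_diff mult.assoc[symmetric] ennreal_mult''[symmetric])
  finally have eq: "ennreal (Gamma t) = ennreal (c powr t) * ?I" .
  have "(\<integral>\<^sup>+\<tau>. ennreal (indicator {0..} \<tau> * \<tau> powr (t - 1) * exp (- (c * \<tau>)) * rGamma t) \<partial>lborel) =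
    (\<integral>\<^sup>+\<tau>. ennreal (indicator {0..} \<tau> * \<tau> powr (t - 1) * exp (- (c * \<tau>))) * ennreal (rGamma t) \<partial>lborel)"
    using G by (intro nn_integral_cong ennreal_mult'') (simp add: rGamma_inverse_Gamma)
  also have "\<dots> = ?I * ennreal (rGamma t)" by (rule nn_integral_multc) simp
  also have "\<dots> = ennreal (c powr (- t)) * (ennreal (c powr t) * ?I) * ennreal (rGamma t)"
    using c by (simp add: powr_minus mult.assoc[symmetric] ennreal_mult''[symmetric])
  also have "\<dots> = ennreal (c powr (- t))"
    using G unfolding eq[symmetric]
    by (simp add: rGamma_inverse_Gamma mult.assoc ennreal_mult''[symmetric])
  finally show ?thesis .
qed

text \<open>Expanding each power by the Gamma integral turns the mixture over \<open>\<omega>\<close> into a mixture of Gaussians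
  over the pairs \<open>(\<omega>, \<tau>)\<close>. The reciprocal Gamma function serves as the normalising factor because it
  is continuous on the whole line and so plainly measurable.\<close>

lemma Lp_multiplier_resolvent_mixture:
  fixes A :: "real^'n \<Rightarrow> real" and N :: "'x measure"
  assumes p: "1 \<le> p" and N: "sigma_finite_measure N"
    and [measurable]: "t \<in> borel_measurable N" "m \<in> borel_measurable N"
    and pos: "\<And>\<omega>. \<omega> \<in> space N \<Longrightarrow> 0 < t \<omega>" "\<And>\<omega>. \<omega> \<in> space N \<Longrightarrow> 0 < m \<omega>"
    and A: "\<And>\<xi>. (\<integral>\<^sup>+\<omega>. ennreal (shifted_laplace (m \<omega>) \<xi> powr (- t \<omega>)) \<partial>N) = ennreal (A \<xi>)" "\<And>\<xi>. 0 \<le> A \<xi>"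
    and slow: "(\<lambda>\<xi>. complex_of_real (A \<xi>)) \<in> slow"
  shows "Lp_multiplier p (\<lambda>\<xi>. complex_of_real (A \<xi>))"
proof -
  interpret N: sigma_finite_measure N by fact
  interpret pair_sigma_finite N "lborel :: real measure" ..
  define W where "W = (\<lambda>(\<omega>, \<tau>::real). ennreal (indicator {0..} \<tau> * \<tau> powr (t \<omega> - 1) * exp (- (m \<omega> * \<tau>)) * rGamma (t \<omega>)))"
  have [measurable]: "(rGamma :: real \<Rightarrow> real) \<in> borel_measurable borel"
    by (intro borel_measurable_continuous_onI continuous_intros)
  have [measurable]: "W \<in> borel_measurable (N \<Otimes>\<^sub>M lborel)" unfolding W_def by measurable
  define \<nu> where "\<nu> = density (N \<Otimes>\<^sub>M lborel) W"
  show ?thesis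
  proof (rule Lp_multiplier_gaussian_mixture[OF p _ _ _ A(2) slow])
    show "snd \<in> borel_measurable \<nu>" unfolding \<nu>_def by measurable
    show "AE x in \<nu>. 0 \<le> snd x"
    proof -
      have "0 \<le> snd x" if "0 < W x" for x
      proof (rule ccontr)
        assume "\<not> 0 \<le> snd x"
        then have "W x = 0" by (cases x) (simp add: W_def)
        with that show False by simp
      qed
      then show ?thesis unfolding \<nu>_def by (subst AE_density) (auto intro!: AE_I2)
    qed
    fix \<xi> :: "real^'n"
    define R where "R = 4 * pi\<^sup>2 * (norm \<xi>)\<^sup>2"
    have R: "R \<ge> 0" by (simp add: R_def)
    have "(\<integral>\<^sup>+x. ennreal (exp (- (R * snd x))) \<partial>\<nu>) = (\<integral>\<^sup>+x. W x * ennreal (exp (- (R * snd x))) \<partial>(N \<Otimes>\<^sub>M lborel))"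
      unfolding \<nu>_def by (rule nn_integral_density) measurable
    also have "\<dots> = (\<integral>\<^sup>+\<omega>. \<integral>\<^sup>+\<tau>. W (\<omega>, \<tau>) * ennreal (exp (- (R * snd (\<omega>, \<tau>)))) \<partial>lborel \<partial>N)"
      by (rule lborel.nn_integral_fst[symmetric]) measurable
    also have "\<dots> = (\<integral>\<^sup>+\<omega>. ennreal ((m \<omega> + R) powr (- t \<omega>)) \<partial>N)"
    proof (rule nn_integral_cong)
      fix \<omega> assume \<omega>: "\<omega> \<in> space N"
      have "rGamma (t \<omega>) \<ge> 0" using Gamma_real_pos[OF pos(1)[OF \<omega>]] by (simp add: rGamma_inverse_Gamma)
      moreover have "exp (- ((m \<omega> + R) * \<tau>)) = exp (- (m \<omega> * \<tau>)) * exp (- (R * \<tau>))" for \<tau>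
        by (simp add: distrib_right mult_exp_exp)
      ultimately have "(\<integral>\<^sup>+\<tau>. W (\<omega>, \<tau>) * ennreal (exp (- (R * snd (\<omega>, \<tau>)))) \<partial>lborel) =
        (\<integral>\<^sup>+\<tau>. ennreal (indicator {0..} \<tau> * \<tau> powr (t \<omega> - 1) * exp (- ((m \<omega> + R) * \<tau>)) * rGamma (t \<omega>)) \<partial>lborel)"
        by (intro nn_integral_cong) (simp add: W_def mult_ac flip: ennreal_mult')
      also have "\<dots> = ennreal ((m \<omega> + R) powr (- t \<omega>))"
        using pos[OF \<omega>] R by (intro gamma_integral_scaled) auto
      finally show "(\<integral>\<^sup>+\<tau>. W (\<omega>, \<tau>) * ennreal (exp (- (R * snd (\<omega>, \<tau>)))) \<partial>lborel) = ennreal ((m \<omega> + R) powr (- t \<omega>))" .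
    qed
    also have "\<dots> = ennreal (A \<xi>)" using A(1)[of \<xi>] by (simp add: R_def)
    finally show "(\<integral>\<^sup>+x. ennreal (exp (- (4 * pi\<^sup>2 * (norm \<xi>)\<^sup>2 * snd x))) \<partial>\<nu>) = ennreal (A \<xi>)"
      by (simp add: R_def)
  qed
qed

text \<open>A mixture concentrated in one point.\<close>

lemma Lp_multiplier_resolvent:
  assumes p: "1 \<le> p" and t: "0 < t" and l: "1 \<le> l"
  shows "Lp_multiplier p (\<lambda>\<xi>::real^'n. complex_of_real (shifted_laplace l \<xi> powr (- t)))"
proof (rule Lp_multiplier_resolvent_mixture[OF p, where N="return borel (0::real)" and t="\<lambda>_. t" and m="\<lambda>_. l"])
  interpret prob_space "return borel (0::real)" by (rule prob_space_return) simp
  show "sigma_finite_measure (return borel (0::real))" ..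
  show "(\<integral>\<^sup>+\<omega>. ennreal (shifted_laplace l \<xi> powr (- t)) \<partial>return borel (0::real)) = ennreal (shifted_laplace l \<xi> powr (- t))" for \<xi> :: "real^'n"
    by (subst nn_integral_return) auto
qed (use t l in \<open>auto intro: slow.powr\<close>)

text \<open>Integrating the exponential function \<open>t \<mapsto> c powr - t\<close> over \<open>t > 0\<close> gives \<open>1 / ln c\<close>.\<close>

lemma Lp_multiplier_inv_ln:
  assumes p: "1 \<le> p" and l: "1 < l"
  shows "Lp_multiplier p (\<lambda>\<xi>::real^'n. complex_of_real (1 / ln (shifted_laplace l \<xi>)))"
proof (rule Lp_multiplier_resolvent_mixture[OF p, where N="restrict_space lborel {0<..}" and t="\<lambda>t. t" and m="\<lambda>_. l"])
  show "sigma_finite_measure (restrict_space lborel {0::real<..})"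
    by (intro sigma_finite_measure_restrict_space sigma_finite_lborel) simp
  show "(\<lambda>t::real. t) \<in> borel_measurable (restrict_space lborel {0<..})"
    by (intro measurable_restrict_space1) simp
  fix \<xi> :: "real^'n"
  define c where "c = shifted_laplace l \<xi>"
  have c: "c > 1" using l shifted_laplace_ge[of l \<xi>] unfolding c_def by linarith
  then have lc: "ln c > 0" by simp
  show "0 \<le> 1 / ln (shifted_laplace l \<xi>)" using lc by (simp add: c_def)
  have "(\<integral>\<^sup>+t. ennreal (c powr (- t)) \<partial>restrict_space lborel {0<..}) = (\<integral>\<^sup>+t. ennreal (c powr (- t)) * indicator {0<..} t \<partial>lborel)"
    by (rule nn_integral_restrict_space) simp
  also have "\<dots> = (\<integral>\<^sup>+t. ennreal (c powr (- t)) * indicator {0..} t \<partial>lborel)"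
  proof (rule nn_integral_cong_AE)
    show "AE t::real in lborel. ennreal (c powr (- t)) * indicator {0<..} t = ennreal (c powr (- t)) * indicator {0..} t"
      using AE_lborel_singleton[of 0] by eventually_elim (auto simp: indicator_def)
  qed
  also have "\<dots> = ennreal (0 - (- (c powr (- 0)) / ln c))"
  proof (rule nn_integral_FTC_atLeast)
    show "((\<lambda>t. - (c powr (- t)) / ln c) has_real_derivative c powr (- t)) (at t)" for t
      using c lc by (auto intro!: derivative_eq_intros)
    have "((\<lambda>t. c powr (- t)) \<longlongrightarrow> 0) at_top" using c by real_asymp
    from tendsto_divide[OF tendsto_minus[OF this] tendsto_const, of "ln c"] lc
    show "((\<lambda>t. - (c powr (- t)) / ln c) \<longlongrightarrow> 0) at_top" by simp
  qed auto
  also have "\<dots> = ennreal (1 / ln c)" using c by simp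
  finally show "(\<integral>\<^sup>+t. ennreal (shifted_laplace l \<xi> powr (- t)) \<partial>restrict_space lborel {0<..}) = ennreal (1 / ln (shifted_laplace l \<xi>))"
    by (simp only: c_def)
next
  show "(\<lambda>\<xi>::real^'n. complex_of_real (1 / ln (shifted_laplace l \<xi>))) \<in> slow" using l by (rule slow.inv_ln)
qed (use l in \<open>auto simp: space_restrict_space\<close>)

text \<open>By the fundamental theorem of calculus the difference is the integral of \<open>(m + r) powr - t\<close> over
  \<open>1 \<le> m \<le> l\<close>. It is used for \<open>F = ln\<close> and for powers with exponent in \<open>(0, 1)\<close>.\<close>

lemma Lp_multiplier_antiderivative_diff:
  assumes p: "1 \<le> p" and l: "1 \<le> l" and t: "0 < t"
    and F: "\<And>x. 1 \<le> x \<Longrightarrow> (F has_real_derivative x powr (- t)) (at x)"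
    and slow: "(\<lambda>\<xi>::real^'n. complex_of_real (F (shifted_laplace l \<xi>) - F (shifted_laplace 1 \<xi>))) \<in> slow"
  shows "Lp_multiplier p (\<lambda>\<xi>::real^'n. complex_of_real (F (shifted_laplace l \<xi>) - F (shifted_laplace 1 \<xi>)))"
proof (rule Lp_multiplier_resolvent_mixture[OF p, where N="restrict_space lborel {1..l}" and t="\<lambda>_. t" and m="\<lambda>m. m"])
  show "sigma_finite_measure (restrict_space lborel {1..l})"
    by (intro sigma_finite_measure_restrict_space sigma_finite_lborel) simp
  show "(\<lambda>t::real. t) \<in> borel_measurable (restrict_space lborel {1..l})"
    by (intro measurable_restrict_space1) simp
  fix \<xi> :: "real^'n"
  define R where "R = 4 * pi\<^sup>2 * (norm \<xi>)\<^sup>2"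
  have R: "R \<ge> 0" by (simp add: R_def)
  have "((\<lambda>m. F (m + R)) has_real_derivative (m + R) powr (- t)) (at m)" if "1 \<le> m" for m
    using DERIV_shift[of F "(m + R) powr (- t)" m R] F[of "m + R"] that R by simp
  then have bi: "has_bochner_integral lborel (\<lambda>m. (m + R) powr (- t) * indicator {1..l} m) (F (l + R) - F (1 + R))"
    using l R by (intro has_bochner_integral_FTC_Icc_real) (auto intro!: continuous_intros)
  have nn: "(\<integral>\<^sup>+m. ennreal ((m + R) powr (- t) * indicator {1..l} m) \<partial>lborel) = ennreal (F (l + R) - F (1 + R))"
    using bi by (subst nn_integral_eq_integral) (auto simp: has_bochner_integral_iff)
  have "0 \<le> (LINT m|lborel. (m + R) powr (- t) * indicator {1..l} m)"
    by (intro Bochner_Integration.integral_nonneg) auto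
  also have "(LINT m|lborel. (m + R) powr (- t) * indicator {1..l} m) = F (l + R) - F (1 + R)"
    using bi by (simp only: has_bochner_integral_iff)
  finally show "0 \<le> F (shifted_laplace l \<xi>) - F (shifted_laplace 1 \<xi>)"
    by (simp only: R_def)
  have "(\<integral>\<^sup>+m. ennreal ((m + R) powr (- t)) \<partial>restrict_space lborel {1..l}) =
      (\<integral>\<^sup>+m. ennreal ((m + R) powr (- t)) * indicator {1..l} m \<partial>lborel)"
    by (rule nn_integral_restrict_space) simp
  also have "\<dots> = ennreal (F (l + R) - F (1 + R))"
    unfolding nn[symmetric] by (intro nn_integral_cong) (auto simp: indicator_def)
  finally show "(\<integral>\<^sup>+m. ennreal (shifted_laplace m \<xi> powr (- t)) \<partial>restrict_space lborel {1..l}) =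
      ennreal (F (shifted_laplace l \<xi>) - F (shifted_laplace 1 \<xi>))"
    by (simp add: R_def)
qed (use t slow in \<open>auto simp: space_restrict_space\<close>)

lemma slow_diff: "a \<in> slow \<Longrightarrow> b \<in> slow \<Longrightarrow> (\<lambda>x. a x - b x) \<in> slow"
  using slow.add[OF _ slow.mult[OF slow.const[of "-1"]], of a b] by simp

text \<open>The restriction \<open>q < 1\<close> makes the derivative of \<open>x powr q\<close> a negative power, so that the
  increment of this function is a positive mixture.\<close>

lemma Lp_multiplier_ratio_fractional:
  assumes p: "1 \<le> p" and l: "1 < l" and q: "0 < q" "q < 1"
  shows "Lp_multiplier p (\<lambda>\<xi>::real^'n. complex_of_real ((shifted_laplace 1 \<xi> / shifted_laplace l \<xi>) powr q))"
proof -
  have s: "(\<lambda>\<xi>::real^'n. complex_of_real (shifted_laplace l' \<xi> powr q / q)) \<in> slow" if "1 \<le> l'" for l'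
    using slow.mult[OF slow.powr[OF that, of q] slow.const[of "1 / complex_of_real q"]] by simp
  have "Lp_multiplier p (\<lambda>\<xi>::real^'n. complex_of_real (shifted_laplace l \<xi> powr q / q - shifted_laplace 1 \<xi> powr q / q))"
  proof (rule Lp_multiplier_antiderivative_diff[OF p, where F="\<lambda>x. x powr q / q" and t="1 - q"])
    show "((\<lambda>x. x powr q / q) has_real_derivative x powr - (1 - q)) (at x)" if "1 \<le> x" for x
      using that q by (auto intro!: derivative_eq_intros)
    show "(\<lambda>\<xi>::real^'n. complex_of_real (shifted_laplace l \<xi> powr q / q - shifted_laplace 1 \<xi> powr q / q)) \<in> slow"
      unfolding of_real_diff using l by (intro slow_diff s) auto
  qed (use l q in auto)
  from Lp_multiplier_one_minus[OF p Lp_multiplier_mult[OF Lp_multiplier_resolvent[OF p q(1), of l] this], of "complex_of_real q"] l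
  have "Lp_multiplier p (\<lambda>\<xi>::real^'n. 1 - complex_of_real q * (complex_of_real (shifted_laplace l \<xi> powr (- q)) *
    complex_of_real (shifted_laplace l \<xi> powr q / q - shifted_laplace 1 \<xi> powr q / q)))" by simp
  moreover have "1 - complex_of_real q * (complex_of_real (shifted_laplace l \<xi> powr (- q)) *
    complex_of_real (shifted_laplace l \<xi> powr q / q - shifted_laplace 1 \<xi> powr q / q)) =
    complex_of_real ((shifted_laplace 1 \<xi> / shifted_laplace l \<xi>) powr q)" for \<xi> :: "real^'n"
  proof -
    have pos: "shifted_laplace l \<xi> > 0" "shifted_laplace 1 \<xi> > 0"
      using l shifted_laplace_ge[of l \<xi>] shifted_laplace_ge[of 1 \<xi>] by linarith+
    have alg: "1 - q * (b powr (- q) * (b powr q / q - a powr q / q)) = (a / b) powr q" if "0 < a" "0 < b" for a b :: real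
      using that q powr_gt_zero[of b q] by (simp add: powr_divide powr_minus field_simps)
    show ?thesis unfolding alg[OF pos(2,1), symmetric] by simp
  qed
  ultimately show ?thesis by simp
qed

lemma Lp_multiplier_ratio:
  assumes p: "1 \<le> p" and l: "1 < l" and s: "0 < s"
  shows "Lp_multiplier p (\<lambda>\<xi>::real^'n. complex_of_real ((shifted_laplace 1 \<xi> / shifted_laplace l \<xi>) powr s))"
proof -
  \<comment> \<open>The exponent \<open>s / N\<close> is below \<open>1\<close>.\<close>
  obtain N :: nat where N: "s < real N" using reals_Archimedean2 by blast
  then have "0 < s / real N" "s / real N < 1" using s by (auto simp: divide_simps)
  from Lp_multiplier_power[OF Lp_multiplier_ratio_fractional[OF p l this], of N]
  have "Lp_multiplier p (\<lambda>\<xi>::real^'n. complex_of_real ((shifted_laplace 1 \<xi> / shifted_laplace l \<xi>) powr (s / real N)) ^ N)" .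
  moreover have "complex_of_real ((shifted_laplace 1 \<xi> / shifted_laplace l \<xi>) powr (s / real N)) ^ N =
    complex_of_real ((shifted_laplace 1 \<xi> / shifted_laplace l \<xi>) powr s)" for \<xi> :: "real^'n"
  proof -
    have "shifted_laplace 1 \<xi> / shifted_laplace l \<xi> > 0"
      using l by (intro divide_pos_pos add_pos_nonneg) auto
    moreover have "(x powr (s / real N)) ^ N = x powr s" if "0 < x" for x :: real
      using that N s by (simp add: powr_power)
    ultimately have "((shifted_laplace 1 \<xi> / shifted_laplace l \<xi>) powr (s / real N)) ^ N = (shifted_laplace 1 \<xi> / shifted_laplace l \<xi>) powr s"
      by blast
    then show ?thesis unfolding of_real_power[symmetric] by (simp only:)
  qed
  ultimately show ?thesis by (simp only:)
qed

lemma Lp_multiplier_symbol_quotient: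
  assumes p: "1 \<le> p" and l: "1 < l" and s: "0 < s"
  obtains M :: "real^'n \<Rightarrow> complex" where "Lp_multiplier p M"
    "\<And>\<xi>. log_bessel_symbol s 1 \<xi> = log_bessel_symbol s l \<xi> * M \<xi>"
proof -
  let ?O = "\<lambda>\<xi>::real^'n. shifted_laplace 1 \<xi>" and ?L = "\<lambda>\<xi>::real^'n. shifted_laplace l \<xi>"
  have "Lp_multiplier p (\<lambda>\<xi>. complex_of_real (ln (?L \<xi>) - ln (?O \<xi>)))"
  proof (rule Lp_multiplier_antiderivative_diff[OF p, where t=1])
    show "(ln has_real_derivative x powr (- 1)) (at x)" if "1 \<le> x" for x :: real
      using DERIV_ln[of x] that by (simp add: powr_minus)
    show "(\<lambda>\<xi>. complex_of_real (ln (?L \<xi>) - ln (?O \<xi>))) \<in> slow"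
      unfolding of_real_diff using l by (intro slow_diff slow.ln) auto
  qed (use l in auto)
  from Lp_multiplier_mult[OF Lp_multiplier_ratio[OF p l s]
      Lp_multiplier_one_minus[OF p Lp_multiplier_mult[OF this Lp_multiplier_inv_ln[OF p l]], of 1]]
  have "Lp_multiplier p (\<lambda>\<xi>. complex_of_real ((?O \<xi> / ?L \<xi>) powr s) *
    (1 - 1 * (complex_of_real (ln (?L \<xi>) - ln (?O \<xi>)) * complex_of_real (1 / ln (?L \<xi>)))))" .
  moreover have "log_bessel_symbol s 1 \<xi> = log_bessel_symbol s l \<xi> * (complex_of_real ((?O \<xi> / ?L \<xi>) powr s) *
    (1 - 1 * (complex_of_real (ln (?L \<xi>) - ln (?O \<xi>)) * complex_of_real (1 / ln (?L \<xi>)))))" for \<xi>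
  proof -
    have "?O \<xi> > 0" by (intro add_pos_nonneg) auto
    moreover have "?L \<xi> > 1" using l shifted_laplace_ge[of l \<xi>] by linarith
    moreover have alg: "a powr s * ln a = b powr s * ln b * ((a / b) powr s * (1 - 1 * ((ln b - ln a) * (1 / ln b))))"
      if "0 < a" "1 < b" for a b :: real
    proof -
      have "ln b \<noteq> 0" using that by (simp add: ln_gt_zero less_imp_neq[THEN not_sym])
      then show ?thesis using that by (simp add: powr_divide field_simps)
    qed
    ultimately have "?O \<xi> powr s * ln (?O \<xi>) = ?L \<xi> powr s * ln (?L \<xi>) *
      ((?O \<xi> / ?L \<xi>) powr s * (1 - 1 * ((ln (?L \<xi>) - ln (?O \<xi>)) * (1 / ln (?L \<xi>)))))" by blast
    then show ?thesis unfolding log_bessel_symbol_def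
      by (simp only: of_real_mult of_real_diff of_real_1)
  qed
  ultimately show ?thesis using that by blast
qed

section \<open>Fourier multipliers on tempered distributions\<close>

lemma log_bessel_symbol_slow: "1 \<le> l \<Longrightarrow> log_bessel_symbol s l \<in> slow"
  unfolding log_bessel_symbol_def[abs_def] of_real_mult by (intro slow.mult slow.powr slow.ln)

lemma fourier_multiplier_apply:
  assumes "a \<in> slow" "f \<in> schwartz"
  shows "fourier_multiplier a u f = u (fourier (\<lambda>\<xi>. a \<xi> * inv_fourier f \<xi>))"
proof -
  have "(\<lambda>\<xi>. a \<xi> * inv_fourier f \<xi>) \<in> schwartz"
    by (intro schwartz_slow_mult schwartz_inv_fourier assms)
  then show ?thesis
    using assms by (simp add: fourier_multiplier_def dist_inv_fourier_def dist_mult_def dist_fourier_def schwartz_inv_fourier)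
qed

lemma fourier_multiplier_eq_dist_of_fun:
  assumes "a \<in> slow"
  shows "fourier_multiplier a u = dist_of_fun h \<longleftrightarrow>
    (\<forall>f\<in>schwartz. u (fourier (\<lambda>\<xi>. a \<xi> * inv_fourier f \<xi>)) = (LINT x|lborel. h x * f x))"
proof -
  have "fourier_multiplier a u \<in> extensional schwartz" "dist_of_fun h \<in> extensional schwartz"
    by (simp_all add: fourier_multiplier_def dist_inv_fourier_def dist_of_fun_def)
  then have "fourier_multiplier a u = dist_of_fun h \<longleftrightarrow> (\<forall>f\<in>schwartz. fourier_multiplier a u f = dist_of_fun h f)"
    by (auto intro: extensionalityI)
  also have "\<dots> \<longleftrightarrow> (\<forall>f\<in>schwartz. u (fourier (\<lambda>\<xi>. a \<xi> * inv_fourier f \<xi>)) = (LINT x|lborel. h x * f x))"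
    by (simp add: fourier_multiplier_apply[OF assms] dist_of_fun_def)
  finally show ?thesis .
qed

text \<open>If \<open>u\<close> is tested against \<open>f\<close> with the symbol for parameter \<open>1\<close>, the factor \<open>M\<close> of that symbol can be
  moved onto the test function; the remaining operator turns \<open>u\<close> into \<open>h\<close>, and the multiplier
  property of \<open>M\<close> moves the factor from the test function to \<open>h\<close>.\<close>

theorem log_bessel_space_mono:
  assumes s: "0 < s" and l: "1 < l" and p: "1 \<le> p"
  shows "(log_bessel_space p s l :: ((real ^ 'n \<Rightarrow> complex) \<Rightarrow> complex) set) \<subseteq> log_bessel_space p s 1"
proof
  fix u :: "(real ^ 'n \<Rightarrow> complex) \<Rightarrow> complex" assume "u \<in> log_bessel_space p s l"
  then obtain h where u: "u \<in> tempered_distributions" and h: "h \<in> Lp_funs p"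
    and eq: "fourier_multiplier (log_bessel_symbol s l) u = dist_of_fun h"
    by (auto simp: log_bessel_space_def log_bessel_op_def)
  have slow: "log_bessel_symbol s l \<in> slow" "log_bessel_symbol s 1 \<in> slow"
    using l by (auto intro: log_bessel_symbol_slow)
  obtain M :: "real ^ 'n \<Rightarrow> complex" where M: "Lp_multiplier p M"
    "\<And>\<xi>. log_bessel_symbol s 1 \<xi> = log_bessel_symbol s l \<xi> * M \<xi>"
    using Lp_multiplier_symbol_quotient[OF p l s] by blast
  then obtain h' where h': "h' \<in> Lp_funs p" "\<And>f. f \<in> schwartz \<Longrightarrow>
    (LINT x|lborel. h' x * f x) = (LINT x|lborel. h x * fourier (\<lambda>\<xi>. M \<xi> * inv_fourier f \<xi>) x)"
    using h unfolding Lp_multiplier_def by blast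
  have Ms: "M \<in> slow" using M(1) by (simp add: Lp_multiplier_def)
  have "u (fourier (\<lambda>\<xi>. log_bessel_symbol s 1 \<xi> * inv_fourier f \<xi>)) = (LINT x|lborel. h' x * f x)"
    if f: "f \<in> schwartz" for f
  proof -
    let ?g = "fourier (\<lambda>\<xi>. M \<xi> * inv_fourier f \<xi>)"
    have "inv_fourier ?g = (\<lambda>\<xi>. M \<xi> * inv_fourier f \<xi>)"
      by (intro fourier_inversion schwartz_slow_mult schwartz_inv_fourier Ms f)
    then have "u (fourier (\<lambda>\<xi>. log_bessel_symbol s 1 \<xi> * inv_fourier f \<xi>)) =
      u (fourier (\<lambda>\<xi>. log_bessel_symbol s l \<xi> * inv_fourier ?g \<xi>))"
      by (simp add: M(2) mult.assoc)
    also have "\<dots> = (LINT x|lborel. h x * ?g x)"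
      using eq schwartz_multiplier[OF Ms f] unfolding fourier_multiplier_eq_dist_of_fun[OF slow(1)] by blast
    finally show ?thesis by (simp add: h'(2)[OF f])
  qed
  then have "fourier_multiplier (log_bessel_symbol s 1) u = dist_of_fun h'"
    unfolding fourier_multiplier_eq_dist_of_fun[OF slow(2)] by blast
  then show "u \<in> log_bessel_space p s 1"
    using u h'(1) by (auto simp: log_bessel_space_def log_bessel_op_def)
qed

section \<open>Coordinate functions as tempered distributions\<close>

lemma topspace_schwartz_topology: "topspace schwartz_topology = schwartz"
proof -
  have "g \<in> \<Union> {{g \<in> schwartz. schwartz_seminorm k is (\<lambda>x. g x - f x) < e} | k is f e. f \<in> schwartz \<and> e > 0}"
    if "g \<in> schwartz" for g :: "real ^ 'a \<Rightarrow> complex"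
  proof -
    let ?e = "\<bar>schwartz_seminorm 0 [] (\<lambda>x. g x - g x)\<bar> + 1"
    have "g \<in> {h \<in> schwartz. schwartz_seminorm 0 [] (\<lambda>x. h x - g x) < ?e}" using that by auto
    moreover have "?e > 0" by linarith
    ultimately show ?thesis using that by blast
  qed
  then show ?thesis
    unfolding schwartz_topology_def topology_generated_by_topspace by blast
qed

lemma schwartz_seminorm_ge:
  assumes "f \<in> schwartz"
  shows "(1 + norm x) ^ k * norm (f x) \<le> schwartz_seminorm k [] f"
proof -
  from schwartz_rapidly_decreasing[OF assms] have "bounded (range (\<lambda>x. (1 + norm x) ^ k * norm (f x)))"
    by (simp add: rapidly_decreasing_iff)
  then have "bdd_above (range (\<lambda>x. (1 + norm x) ^ k * norm (f x)))" by (rule bounded_imp_bdd_above)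
  from cSUP_upper[OF UNIV_I this, of x] show ?thesis by (simp add: schwartz_seminorm_def)
qed

lemma slow_pairing_integrable:
  assumes "a \<in> slow" "f \<in> schwartz"
  shows "integrable lborel (\<lambda>x. a x * f x)"
  by (intro schwartz_integrable schwartz_slow_mult assms)

lemma slow_pairing_bound:
  fixes a :: "real ^ 'n \<Rightarrow> complex"
  assumes a: "a \<in> slow"
  obtains K k where "K > 0" "\<And>f. f \<in> schwartz \<Longrightarrow> norm (LINT x|lborel. a x * f x) \<le> K * schwartz_seminorm k [] f"
proof -
  from slow_bound[OF a] obtain C m where C: "C \<ge> 0" "\<And>x. norm (a x) \<le> C * (1 + norm x) ^ m" by blast
  \<comment> \<open>Spending \<open>2 * CARD('n)\<close> extra powers of \<open>1 + norm x\<close> makes the pairing absolutely convergent.\<close>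
  define d where "d x = 1 / (1 + norm x) ^ (2 * CARD('n))" for x :: "real ^ 'n"
  have d: "integrable lborel d" unfolding d_def[abs_def] by (rule integrable_decay)
  have "d x \<ge> 0" for x by (simp add: d_def)
  then have I: "0 \<le> (LINT x|lborel. d x)" by (simp add: integral_nonneg)
  have "norm (LINT x|lborel. a x * f x) \<le> (C * (LINT x|lborel. d x) + 1) * schwartz_seminorm (m + 2 * CARD('n)) [] f"
    if f: "f \<in> schwartz" for f
  proof -
    let ?N = "schwartz_seminorm (m + 2 * CARD('n)) [] f"
    have N: "(1 + norm x) ^ (m + 2 * CARD('n)) * norm (f x) \<le> ?N" for x by (rule schwartz_seminorm_ge[OF f])
    have N0: "0 \<le> ?N" by (rule order_trans[OF _ N[of 0]]) simp
    have le: "norm (a x * f x) \<le> C * ?N * d x" for x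
    proof -
      have pos: "(1 + norm x) ^ (2 * CARD('n)) > 0" by (simp add: add_pos_nonneg)
      have "(1 + norm x) ^ m * norm (f x) \<le> ?N * d x"
        using N[of x] pos by (simp add: d_def power_add pos_le_divide_eq mult_ac)
      then have "C * ((1 + norm x) ^ m * norm (f x)) \<le> C * (?N * d x)" by (rule mult_left_mono) fact
      moreover have "norm (a x * f x) \<le> C * (1 + norm x) ^ m * norm (f x)"
        unfolding norm_mult by (rule mult_right_mono[OF C(2)]) simp
      ultimately show ?thesis by (simp add: mult.assoc)
    qed
    have "norm (LINT x|lborel. a x * f x) \<le> (LINT x|lborel. norm (a x * f x))" by (rule integral_norm_bound)
    also have "\<dots> \<le> (LINT x|lborel. C * ?N * d x)"
      using le d by (intro integral_mono integrable_norm slow_pairing_integrable a f integrable_mult_right)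
    also have "\<dots> = C * (LINT x|lborel. d x) * ?N" by simp
    also have "\<dots> \<le> (C * (LINT x|lborel. d x) + 1) * ?N" using N0 by (intro mult_right_mono) auto
    finally show ?thesis .
  qed
  moreover have "C * (LINT x|lborel. d x) + 1 > 0" using C(1) I by (simp add: add_nonneg_pos)
  ultimately show ?thesis using that by blast
qed

text \<open>By polynomial growth the pairing is bounded by a single seminorm, and balls of that seminorm are
  among the sets that generate the topology.\<close>

lemma dist_of_slow_tempered:
  fixes a :: "real ^ 'n \<Rightarrow> complex"
  assumes a: "a \<in> slow"
  shows "dist_of_fun a \<in> tempered_distributions"
proof -
  let ?u = "dist_of_fun a"
  have u: "?u f = (LINT x|lborel. a x * f x)" if "f \<in> schwartz" for f
    using that by (simp add: dist_of_fun_def)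
  have add: "?u (\<lambda>x. f x + g x) = ?u f + ?u g" if "f \<in> schwartz" "g \<in> schwartz" for f g
    using that slow_pairing_integrable[OF a] by (simp add: u schwartz_add distrib_left)
  have mult: "?u (\<lambda>x. c * f x) = c * ?u f" if "f \<in> schwartz" for c f
  proof -
    have "(LINT x|lborel. a x * (c * f x)) = (LINT x|lborel. c * (a x * f x))" by (simp add: mult_ac)
    then show ?thesis using that by (simp add: u schwartz_cmult)
  qed
  obtain K k where K: "K > 0" "\<And>f. f \<in> schwartz \<Longrightarrow> norm (LINT x|lborel. a x * f x) \<le> K * schwartz_seminorm k [] f"
    using slow_pairing_bound[OF a] by blast
  have "continuous_map schwartz_topology euclidean ?u"
    unfolding continuous_map_def
  proof (intro conjI allI impI)
    show "?u \<in> topspace schwartz_topology \<rightarrow> topspace euclidean" by simp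
    fix U :: "complex set" assume "openin euclidean U"
    then have U: "open U" by simp
    show "openin schwartz_topology {f \<in> topspace schwartz_topology. ?u f \<in> U}"
    proof (subst openin_subopen, intro ballI)
      fix f assume "f \<in> {f \<in> topspace schwartz_topology. ?u f \<in> U}"
      then have f: "f \<in> schwartz" "?u f \<in> U" by (auto simp: topspace_schwartz_topology)
      from U f(2) obtain e where e: "e > 0" "ball (?u f) e \<subseteq> U" by (meson open_contains_ball)
      define T where "T = {g \<in> schwartz. schwartz_seminorm k [] (\<lambda>x. g x - f x) < e / K}"
      have "e / K > 0" using e(1) K(1) by simp
      then have "T \<in> {{g \<in> schwartz. schwartz_seminorm k is (\<lambda>x. g x - f x) < e} | k is f e. f \<in> schwartz \<and> e > 0}"
        unfolding T_def using f(1) by blast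
      then have "openin schwartz_topology T"
        unfolding schwartz_topology_def by (rule topology_generated_by_Basis)
      moreover have "f \<in> T" using f(1) \<open>e / K > 0\<close> by (simp add: T_def schwartz_seminorm_def)
      moreover have "T \<subseteq> {f \<in> topspace schwartz_topology. ?u f \<in> U}"
      proof
        fix g assume "g \<in> T"
        then have g: "g \<in> schwartz" "schwartz_seminorm k [] (\<lambda>x. g x - f x) < e / K" by (auto simp: T_def)
        have gf: "(\<lambda>x. g x - f x) \<in> schwartz" using g(1) f(1) by (rule schwartz_diff)
        have "?u g = ?u f + ?u (\<lambda>x. g x - f x)" using add[OF f(1) gf] by simp
        then have "dist (?u f) (?u g) = norm (?u (\<lambda>x. g x - f x))" by (simp add: dist_norm)
        also have "\<dots> \<le> K * schwartz_seminorm k [] (\<lambda>x. g x - f x)" using K(2)[OF gf] by (simp add: u[OF gf])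
        also have "\<dots> < e" using g(2) K(1) by (simp add: field_simps)
        finally have "?u g \<in> U" using e(2) by auto
        then show "g \<in> {f \<in> topspace schwartz_topology. ?u f \<in> U}" using g(1) by (simp add: topspace_schwartz_topology)
      qed
      ultimately show "\<exists>T. openin schwartz_topology T \<and> f \<in> T \<and> T \<subseteq> {f \<in> topspace schwartz_topology. ?u f \<in> U}" by blast
    qed
  qed
  moreover have "?u \<in> extensional schwartz" by (simp add: dist_of_fun_def)
  ultimately show ?thesis using add mult unfolding tempered_distributions_def by blast
qed

text \<open>The transform of a coordinate function is a multiple of the derivative of the Dirac measure,
  here in the form tested against \<open>g\<close>.\<close>

lemma integral_coord_fourier:
  assumes g: "g \<in> schwartz"
  shows "2 * complex_of_real pi * \<i> * (LINT x|lborel. complex_of_real (x $ i) * fourier g x) = partial_deriv i g 0"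
proof -
  have pg: "partial_deriv i g \<in> schwartz" by (rule schwartz_partial_deriv[OF g])
  have "partial_deriv i g 0 = (LINT x|lborel. fourier (partial_deriv i g) x)"
    using fun_cong[OF fourier_inversion[OF pg], of 0] plane_wave_commute[of 0] by (simp add: inv_fourier_eq)
  also have "\<dots> = (LINT x|lborel. 2 * complex_of_real pi * \<i> * (complex_of_real (x $ i) * fourier g x))"
    by (simp add: fourier_partial_deriv[OF g] mult.assoc)
  also have "\<dots> = 2 * complex_of_real pi * \<i> * (LINT x|lborel. complex_of_real (x $ i) * fourier g x)"
    by (rule integral_mult_right_zero)
  finally show ?thesis by simp
qed

text \<open>The operator with symbol \<open>a\<close> multiplies a coordinate function by \<open>a 0\<close> when the derivative of the
  symbol vanishes at the origin. Both sides are evaluated by the preceding formula, for \<open>a\<close> and for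
  the constant symbol \<open>1\<close>.\<close>

lemma integral_coord_multiplier:
  assumes a: "a \<in> slow" "partial_deriv i a 0 = 0" and f: "f \<in> schwartz"
  shows "(LINT x|lborel. complex_of_real (x $ i) * fourier (\<lambda>\<xi>. a \<xi> * inv_fourier f \<xi>) x) =
    a 0 * (LINT x|lborel. complex_of_real (x $ i) * f x)"
proof -
  let ?c = "2 * complex_of_real pi * \<i>"
  have g: "inv_fourier f \<in> schwartz" by (rule schwartz_inv_fourier[OF f])
  have "?c * (LINT x|lborel. complex_of_real (x $ i) * fourier (\<lambda>\<xi>. a \<xi> * inv_fourier f \<xi>) x) =
    partial_deriv i (\<lambda>\<xi>. a \<xi> * inv_fourier f \<xi>) 0"
    by (intro integral_coord_fourier schwartz_slow_mult a g)
  also have "\<dots> = a 0 * partial_deriv i (inv_fourier f) 0"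
    by (simp add: partial_deriv_mult[OF slow_differentiable[OF a(1)] schwartz_differentiable[OF g]] a(2))
  also have "\<dots> = a 0 * (?c * (LINT x|lborel. complex_of_real (x $ i) * f x))"
    using integral_coord_fourier[OF g, of i] by (simp add: fourier_inversion'[OF f])
  finally have "?c * (LINT x|lborel. complex_of_real (x $ i) * fourier (\<lambda>\<xi>. a \<xi> * inv_fourier f \<xi>) x) =
    ?c * (a 0 * (LINT x|lborel. complex_of_real (x $ i) * f x))" by (simp only: mult_ac)
  then show ?thesis by (subst (asm) mult_cancel_left) simp
qed

lemma partial_deriv_log_bessel_symbol_0:
  assumes "1 \<le> l"
  shows "partial_deriv i (log_bessel_symbol s l) 0 = 0"
proof -
  have "((\<lambda>t. t powr s * ln t) has_real_derivative s * l powr (s - 1) * ln l + l powr s * (1 / l)) (at l)"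
    using assms by (auto intro!: derivative_eq_intros)
  then have "((\<lambda>t. t powr s * ln t) has_real_derivative s * l powr (s - 1) * ln l + l powr s * (1 / l))
    (at (shifted_laplace l (0 :: real ^ 'a)))" by simp
  from partial_deriv_eq[OF has_derivative_radial[OF this], of i]
  show ?thesis unfolding log_bessel_symbol_def[abs_def] by simp
qed

text \<open>Pairing with Gaussians translated by \<open>r\<close> along the axis grows linearly in \<open>r\<close> for the coordinate
  function but stays bounded for \<open>h\<close>.\<close>

lemma coordinate_not_Lp:
  fixes h :: "real ^ 'n \<Rightarrow> complex"
  assumes p: "1 \<le> p" and h: "h \<in> Lp_funs p" and c: "c \<noteq> 0"
    and eq: "\<And>f. f \<in> schwartz \<Longrightarrow> c * (LINT x|lborel. complex_of_real (x $ i) * f x) = (LINT x|lborel. h x * f x)"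
  shows False
proof -
  define J where "J = (LINT x|lborel. complex_of_real ((x :: real ^ 'n) $ i) * gauss x)"
  obtain K where K: "\<And>t. (LINT x|lborel. norm (h x * gauss (t + x))) \<le> K"
    using Lp_pairing[OF p h schwartz_gauss] by blast
  have bound: "norm c * norm (J + complex_of_real r) \<le> K" for r
  proof -
    define t :: "real ^ 'n" where "t = axis i r"
    let ?f = "\<lambda>x. gauss (- t + x)"
    have f: "?f \<in> schwartz" using schwartz_isometry[OF schwartz_gauss, of 1 "- t"] by simp
    have meas: "(\<lambda>x. complex_of_real (x $ i) * ?f x) \<in> borel_measurable borel"
      by (intro schwartz_measurable schwartz_slow_mult slow.coord f)
    have "(LINT x|lborel. complex_of_real (x $ i) * ?f x) = (LINT x|lborel. complex_of_real ((t + x) $ i) * gauss x)"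
      using integral_translate[OF meas, of t] by simp
    also have "\<dots> = (LINT x|lborel. complex_of_real (x $ i) * gauss x + complex_of_real r * gauss x)"
      by (simp add: t_def algebra_simps)
    also have "\<dots> = J + complex_of_real r"
      using slow_pairing_integrable[OF slow.coord schwartz_gauss, where 'a='n]
        schwartz_integrable[OF schwartz_gauss, where 'a='n]
      by (simp add: J_def integral_gauss)
    finally have "c * (J + complex_of_real r) = (LINT x|lborel. h x * ?f x)" using eq[OF f] by simp
    then have "norm c * norm (J + complex_of_real r) = norm (LINT x|lborel. h x * ?f x)" by (simp flip: norm_mult)
    also have "\<dots> \<le> (LINT x|lborel. norm (h x * ?f x))" by (rule integral_norm_bound)
    also have "\<dots> \<le> K" by (rule K)
    finally show ?thesis .
  qed
  \<comment> \<open>Large enough for \<open>norm c * (r - norm J)\<close> to exceed \<open>K\<close>.\<close>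
  define r where "r = \<bar>K\<bar> / norm c + norm J + 1"
  have "0 \<le> \<bar>K\<bar> / norm c" by simp
  then have "norm (complex_of_real r) = r" unfolding r_def norm_of_real using norm_ge_zero[of J] by linarith
  then have "r - norm J \<le> norm (J + complex_of_real r)"
    using norm_diff_ineq[of "complex_of_real r" J] by (simp add: add.commute)
  then have "norm c * (r - norm J) \<le> norm c * norm (J + complex_of_real r)" by (rule mult_left_mono) simp
  also have "\<dots> \<le> K" by (rule bound)
  finally have "norm c * (r - norm J) \<le> K" .
  moreover have "norm c * (r - norm J) = \<bar>K\<bar> + norm c" using c by (simp add: r_def field_simps)
  moreover have "0 < norm c" using c by simp
  ultimately show False by linarith
qed

section \<open>The strict inclusion\<close>

theorem proposition1p11:
  fixes s lam :: real and p :: ennreal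
  assumes "s > 0" and "lam > 1" and "1 \<le> p"
  shows "(log_bessel_space p s lam :: ((real ^ 'n \<Rightarrow> complex) \<Rightarrow> complex) set)
    \<subset> log_bessel_space p s 1"
proof -
  define i :: 'n where "i = (SOME i. True)"
  define x_i :: "real ^ 'n \<Rightarrow> complex" where "x_i x = complex_of_real (x $ i)" for x
  define u where "u = dist_of_fun x_i"
  have x_i: "x_i \<in> slow" unfolding x_i_def[abs_def] by (rule slow.coord)
  have op: "u (fourier (\<lambda>\<xi>. log_bessel_symbol s l \<xi> * inv_fourier f \<xi>)) =
      complex_of_real (l powr s * ln l) * (LINT x|lborel. x_i x * f x)"
    if "1 \<le> l" "f \<in> schwartz" for l f
    using integral_coord_multiplier[OF log_bessel_symbol_slow[OF that(1)] partial_deriv_log_bessel_symbol_0[OF that(1)] that(2)]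
      schwartz_multiplier[OF log_bessel_symbol_slow[OF that(1)] that(2)]
    by (simp add: u_def dist_of_fun_def x_i_def log_bessel_symbol_def)
  have "u \<in> log_bessel_space p s 1"
  proof -
    have "fourier_multiplier (log_bessel_symbol s 1) u = dist_of_fun (\<lambda>x. 0)"
      unfolding fourier_multiplier_eq_dist_of_fun[OF log_bessel_symbol_slow[OF order_refl]]
      using op[of 1] by simp
    moreover have "(\<lambda>x. 0) \<in> Lp_funs p" by (auto simp: Lp_funs_def)
    ultimately show ?thesis
      using dist_of_slow_tempered[OF x_i] by (auto simp: log_bessel_space_def log_bessel_op_def u_def)
  qed
  moreover have "u \<notin> log_bessel_space p s lam"
  proof
    have lam: "1 \<le> lam" using assms by simp
    assume "u \<in> log_bessel_space p s lam"
    then obtain h where h: "h \<in> Lp_funs p" "fourier_multiplier (log_bessel_symbol s lam) u = dist_of_fun h"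
      by (auto simp: log_bessel_space_def log_bessel_op_def)
    have "complex_of_real (lam powr s * ln lam) * (LINT x|lborel. complex_of_real (x $ i) * f x) = (LINT x|lborel. h x * f x)"
      if "f \<in> schwartz" for f
      using h(2) op[OF lam that] that
      unfolding fourier_multiplier_eq_dist_of_fun[OF log_bessel_symbol_slow[OF lam]] x_i_def by metis
    moreover have "complex_of_real (lam powr s * ln lam) \<noteq> 0" using assms by simp
    ultimately show False using coordinate_not_Lp[OF assms(3) h(1)] by blast
  qed
  ultimately show ?thesis using log_bessel_space_mono[OF assms] by blast
qed

end
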